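(* Let $n\ge2$ and $\Lambda\in\wedge^*_{\mathbb{Q},+}\cap\mathcal{C}_{\mathrm{hol}}$. Then, for $G=SU(n,1)$, $$\Delta_K(\mathcal{O}_\Lambda)=\{\xi\in\mathfrak{t}^*:\langle\xi,\chi_1\rangle\ge\langle\Lambda,\chi_1\rangle\ge\langle\xi,\chi_2\rangle\ge\langle\Lambda,\chi_2\rangle\ge\dots\ge\langle\xi,\chi_n\rangle\ge\langle\Lambda,\chi_n\rangle\}.$$
   Context: $SU(n,1)=\{M\in SL_{n+1}(\mathbb{C}):{}^t\overline{M}I_{n,1}M=I_{n,1}\}$ with $I_{n,1}=\mathrm{diag}(1,\dots,1,-1)$. $K=\left\{\begin{pmatrix}A&0\\0&\det(A)^{-1}\end{pmatrix}:A\in U(n)\right\}\cong U(n)$, $T$ is the torus of diagonal matrices in $K$, with Lie algebra $\mathfrak{t}$, which has basis $e_1,\dots,e_n$, $e_k$ being the diagonal matrix with $k$-th entry $i$, last entry $-i$, and $0$ elsewhere; $(e_k^* )$ is the dual basis of $\mathfrak{t}^*$ and $\xi=(\xi_1,\dots,\xi_n)$ the coordinates in it. $\mathfrak{t}_+^*=\{\xi_1\ge\dots\ge\xi_n\}$, $\wedge^*_{\mathbb{Q}}=\mathbb{Q}^n$, $\wedge^*_{\mathbb{Q},+}=\mathbb{Q}^n\cap\mathfrak{t}_+^*$. The positive noncompact roots are $\beta_k=e_k^*+\sum_{j=1}^ne_j^*$, $k=1,\dots,n$, and $\mathcal{C}_{\mathrm{hol}}=\{\xi\in\mathfrak{t}_+^*:(\beta_k,\xi)>0\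 \forall k\}$ for the inner product induced by the Killing form, i.e. $\xi_1\ge\dots\ge\xi_n>0$. $\chi_k=(n+1)e_k-\sum_{i=1}^ne_i\in\mathfrak{t}$. $\mathcal{O}_\Lambda=G\cdot\Lambda\subset\mathfrak{g}^*$ is the coadjoint orbit ($\mathfrak{t}^*\subset\mathfrak{k}^*\subset\mathfrak{g}^*$ via the Killing form) and $\Delta_K(\mathcal{O}_\Lambda)$ is the intersection with $\mathfrak{t}_+^*$ of the image of $\mathcal{O}_\Lambda$ under the restriction map $\mathfrak{g}^*\to\mathfrak{k}^*$. *)

theory Defs
  imports "HOL-Analysis.Analysis"
begin

text \<open>
  The integer \<open>n\<close> is the cardinality of a finite linearly ordered index type \<open>'n\<close>, whose elements
  stand for \<open>1 < \<dots> < n\<close>. Square matrices of size \<open>n + 1\<close> are indexed by \<open>'n option\<close>: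
  \<open>Some k\<close> is the index \<open>k\<close> and \<open>None\<close> is the last index \<open>n + 1\<close>.
\<close>

type_synonym 'n cmat = "complex^('n option)^('n option)"

definition conj_transpose :: "complex^'m^'m \<Rightarrow> complex^'m^'m" where
  "conj_transpose M = (\<chi> i j. cnj (M $ j $ i))"


subsection \<open>The groups\<close>

definition I_n1 :: "('n::finite) cmat" where
  "I_n1 = (\<chi> i j. if i = j then (if i = None then - 1 else 1) else 0)"

definition SU_n1 :: "('n::finite) cmat set" where
  "SU_n1 = {M. det M = 1 \<and> conj_transpose M ** I_n1 ** M = I_n1}"

definition unitary_group :: "(complex^'m^'m) set" where
  "unitary_group = {A. conj_transpose A ** A = mat 1}"

definition block_diag :: "complex^'n^'n \<Rightarrow> complex \<Rightarrow> ('n::finite) cmat" where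
  "block_diag A d = (\<chi> i j. case (i, j) of
       (Some a, Some b) \<Rightarrow> A $ a $ b
     | (None, None) \<Rightarrow> d
     | _ \<Rightarrow> 0)"

definition K_grp :: "('n::finite) cmat set" where
  "K_grp = (\<lambda>A. block_diag A (inverse (det A))) ` unitary_group"

definition T_grp :: "('n::finite) cmat set" where
  "T_grp = {M \<in> K_grp. \<forall>i j. i \<noteq> j \<longrightarrow> M $ i $ j = 0}"


subsection \<open>Lie algebras, duals and the Killing form\<close>

text \<open>The Lie algebra of a matrix group is its tangent space at the identity.\<close>

definition lie_algebra :: "(complex^'m^'m) set \<Rightarrow> (complex^'m^'m) set" where
  "lie_algebra H = {X. \<exists>\<gamma> :: real \<Rightarrow> complex^'m^'m.
      (\<forall>t. \<gamma> t \<in> H \<and> \<gamma> differentiable (at t)) \<and> \<gamma> 0 = mat 1 \<and>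
      (\<gamma> has_vector_derivative X) (at 0)}"

definition lie_g :: "('n::finite) cmat set" where
  "lie_g = lie_algebra SU_n1"

definition lie_k :: "('n::finite) cmat set" where
  "lie_k = lie_algebra K_grp"

definition lie_t :: "('n::finite) cmat set" where
  "lie_t = lie_algebra T_grp"

text \<open>The dual of a real subspace \<open>V\<close>; functionals are taken to be \<open>undefined\<close> outside \<open>V\<close>, so
  that equality of functionals is equality on \<open>V\<close>.\<close>

definition dual :: "('v::real_vector) set \<Rightarrow> ('v \<Rightarrow> real) set" where
  "dual V = {f \<in> extensional V.
     (\<forall>x\<in>V. \<forall>y\<in>V. f (x + y) = f x + f y) \<and> (\<forall>c. \<forall>x\<in>V. f (c *\<^sub>R x) = c * f x)}"

text \<open>The trace of an endomorphism \<open>f\<close> of a finite-dimensional real subspace \<open>V\<close>, computed in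
  an arbitrarily chosen basis of \<open>V\<close>.\<close>

definition trace_on :: "('v::real_vector) set \<Rightarrow> ('v \<Rightarrow> 'v) \<Rightarrow> real" where
  "trace_on V f = (let B = (SOME B. independent B \<and> span B = V)
                   in \<Sum>b\<in>B. representation B (f b) b)"

definition ad :: "complex^'m^'m \<Rightarrow> complex^'m^'m \<Rightarrow> complex^'m^'m" where
  "ad X Y = X ** Y - Y ** X"

definition killing :: "('n::finite) cmat \<Rightarrow> 'n cmat \<Rightarrow> real" where
  "killing X Y = trace_on lie_g (ad X \<circ> ad Y)"

text \<open>For a subspace \<open>W\<close> of \<open>\<gg>\<close> on which the Killing form is nondegenerate,
  \<open>killing_vec W f\<close> is the vector of \<open>W\<close> representing \<open>f \<in> W\<^sup>*\<close>, and \<open>killing_embed W V\<close> is the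
  resulting inclusion \<open>W\<^sup>* \<cong> W \<subseteq> V \<rightarrow> V\<^sup>*\<close> for \<open>W \<subseteq> V\<close>.\<close>

definition killing_vec :: "('n::finite) cmat set \<Rightarrow> ('n cmat \<Rightarrow> real) \<Rightarrow> 'n cmat" where
  "killing_vec W f = (THE X. X \<in> W \<and> (\<forall>Y\<in>W. killing X Y = f Y))"

definition killing_embed ::
    "('n::finite) cmat set \<Rightarrow> 'n cmat set \<Rightarrow> ('n cmat \<Rightarrow> real) \<Rightarrow> ('n cmat \<Rightarrow> real)" where
  "killing_embed W V f = restrict (killing (killing_vec W f)) V"

text \<open>The Killing form is negative definite on the compact subalgebra \<open>\<tt>\<close>, so the inner product
  it induces on \<open>\<tt>\<^sup>*\<close> carries a minus sign.\<close>

definition t_dual_inner :: "(('n::finite) cmat \<Rightarrow> real) \<Rightarrow> ('n cmat \<Rightarrow> real) \<Rightarrow> real" where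
  "t_dual_inner \<alpha> \<beta> = - killing (killing_vec lie_t \<alpha>) (killing_vec lie_t \<beta>)"


subsection \<open>Weights and chambers\<close>

definition e_vec :: "'n \<Rightarrow> ('n::finite) cmat" where
  "e_vec k = (\<chi> i j. if i = j then
      (if i = Some k then \<i> else if i = None then - \<i> else 0) else 0)"

text \<open>The dual basis: \<open>\<Sum>k. x\<^sub>k e\<^sub>k\<close> has \<open>k\<close>-th diagonal entry \<open>\<i> x\<^sub>k\<close>.\<close>

definition e_dual :: "'n \<Rightarrow> ('n::finite) cmat \<Rightarrow> real" where
  "e_dual k = restrict (\<lambda>X. Im (X $ Some k $ Some k)) lie_t"

text \<open>The coordinates of \<open>\<xi> \<in> \<tt>\<^sup>*\<close> in the dual basis are \<open>\<xi> (e_vec k)\<close>.\<close>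

definition t_plus :: "(('n::{finite,linorder}) cmat \<Rightarrow> real) set" where
  "t_plus = {\<xi> \<in> dual lie_t. \<forall>j k. j \<le> k \<longrightarrow> \<xi> (e_vec j) \<ge> \<xi> (e_vec k)}"

definition wedge_Q :: "(('n::finite) cmat \<Rightarrow> real) set" where
  "wedge_Q = {\<xi> \<in> dual lie_t. \<forall>k. \<xi> (e_vec k) \<in> \<rat>}"

definition wedge_Q_plus :: "(('n::{finite,linorder}) cmat \<Rightarrow> real) set" where
  "wedge_Q_plus = wedge_Q \<inter> t_plus"

definition beta :: "'n \<Rightarrow> ('n::finite) cmat \<Rightarrow> real" where
  "beta k = restrict (\<lambda>X. e_dual k X + (\<Sum>j\<in>UNIV. e_dual j X)) lie_t"

definition C_hol :: "(('n::{finite,linorder}) cmat \<Rightarrow> real) set" where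
  "C_hol = {\<xi> \<in> t_plus. \<forall>k. t_dual_inner (beta k) \<xi> > 0}"

definition chi_vec :: "'n \<Rightarrow> ('n::finite) cmat" where
  "chi_vec k = (real CARD('n) + 1) *\<^sub>R e_vec k - (\<Sum>i\<in>UNIV. e_vec i)"


subsection \<open>Coadjoint orbits and their projections\<close>

definition coadjoint ::
    "('n::finite) cmat \<Rightarrow> ('n cmat \<Rightarrow> real) \<Rightarrow> ('n cmat \<Rightarrow> real)" where
  "coadjoint g f = restrict (\<lambda>X. f (matrix_inv g ** X ** g)) lie_g"

definition coadjoint_orbit :: "(('n::finite) cmat \<Rightarrow> real) \<Rightarrow> ('n cmat \<Rightarrow> real) set" where
  "coadjoint_orbit \<Lambda> = (\<lambda>g. coadjoint g (killing_embed lie_t lie_g \<Lambda>)) ` SU_n1"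

definition Delta_K :: "(('n::{finite,linorder}) cmat \<Rightarrow> real) set \<Rightarrow> ('n cmat \<Rightarrow> real) set" where
  "Delta_K \<O> = {\<xi> \<in> t_plus. killing_embed lie_t lie_k \<xi> \<in> (\<lambda>f. restrict f lie_k) ` \<O>}"

definition consecutive :: "'a::linorder \<Rightarrow> 'a \<Rightarrow> bool" where
  "consecutive k l \<longleftrightarrow> k < l \<and> \<not> (\<exists>m. k < m \<and> m < l)"

end

theory Submission
  imports Defs "HOL-Computational_Algebra.Polynomial"
begin

text \<open>
  On \<open>\<gg> = \<ss>\<uu>(n,1)\<close> the Killing form is \<open>2 (n + 1) Re (tr (X Y))\<close>, so \<open>\<Lambda>\<close> corresponds to the
  matrix \<open>- \<i> diag(\<lambda>\<^sub>1, \<dots>, \<lambda>\<^sub>n, - s)\<close> up to a positive factor, where \<open>\<lambda>\<^sub>k = \<langle>\<Lambda>, \<chi>\<^sub>k\<rangle>\<close> and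
  \<open>s = \<lambda>\<^sub>1 + \<dots> + \<lambda>\<^sub>n\<close>, and restriction to \<open>\<kk>\<close> keeps the diagonal blocks. Adding the scalar \<open>s\<close>
  turns the last eigenvalue into 0, and the upper left block of \<open>g D g\<^sup>-\<^sup>1\<close> becomes \<open>A \<mu> A\<^sup>*\<close>,
  where \<open>A\<close> is the upper left block of \<open>g\<close> and \<open>\<mu>\<^sub>k = \<lambda>\<^sub>k + s\<close>; the condition \<open>\<Lambda> \<in> C_hol\<close> says
  that all \<open>\<mu>\<^sub>k\<close> are positive. Since \<open>A\<^sup>* A = 1 + w w\<^sup>*\<close> with \<open>w\<close> arbitrary, \<open>A \<mu> A\<^sup>*\<close> has the
  eigenvalues of an arbitrary positive rank-one perturbation of \<open>\<mu>\<close>, and these are exactly the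
  tuples that interlace with \<open>\<mu>\<close>.
\<close>

section \<open>Interlacing and rank-one perturbations\<close>

text \<open>The two halves of the overview are linked by the factorization
  \<open>A \<mu> A* = (A \<mu>^(1/2)) (A \<mu>^(1/2))*\<close>: exchanging the factors keeps the
  spectrum and gives \<open>\<mu>^(1/2) A* A \<mu>^(1/2) = \<mu> + v v*\<close> with
  \<open>v = \<mu>^(1/2) w\<close>. Positivity of \<mu> is what admits the square roots. Existence
  rests on explicit formulas: \<open>v\<close> is read off from residues of a rational function and
  the eigenvectors are written down, all over the reals. Necessity compares quadratic forms on
  solutions of small linear systems, in the manner of Courant-Fischer. A second obstacle lies in the
  definitions. Lie algebras are sets of velocities of curves that are differentiable at all times,
  and the Killing form is a trace in an unspecified basis of a real space. Both have to be computed
  before functionals can be replaced by matrices.\<close>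

lemma degree_prod_linear:
  "degree (\<Prod>j\<in>A. [:- (a j :: real), 1:]) = card A"
  by (subst degree_prod_eq_sum_degree) auto

text \<open>After multiplication by the denominator both sides are monic of degree \<open>n\<close>
  and agree at the \<open>n\<close> distinct points \<open>\<mu> k\<close>. The numerators are minus
  the residues of the quotient at these points. If they equal \<open>v k ^ 2\<close>, the quotient
  is that of the characteristic polynomials of \<open>diag \<mu> + v v^T\<close> and
  \<open>diag \<mu>\<close>.\<close>

lemma sum_partial_fractions:
  fixes \<alpha> \<mu> :: "'n::finite \<Rightarrow> real"
  assumes inj: "inj \<mu>" and ne: "\<And>k. x \<noteq> \<mu> k"
  shows "(\<Prod>j\<in>UNIV. x - \<alpha> j) / (\<Prod>j\<in>UNIV. x - \<mu> j) =
    1 - (\<Sum>k\<in>UNIV. ((\<alpha> k - \<mu> k) * (\<Prod>j\<in>UNIV-{k}. (\<mu> k - \<alpha> j) / (\<mu> k - \<mu> j))) / (x - \<mu> k))"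
proof -
  define w where "w k = (\<alpha> k - \<mu> k) * (\<Prod>j\<in>UNIV-{k}. (\<mu> k - \<alpha> j) / (\<mu> k - \<mu> j))" for k
  let ?n = "CARD('n)"
  define p where "p = (\<Prod>j\<in>UNIV. [:- \<alpha> j, 1:])"
  define s where "s = (\<Sum>k\<in>UNIV. smult (w k) (\<Prod>j\<in>UNIV-{k}. [:- \<mu> j, 1:]))"
  define q where "q = (\<Prod>j\<in>UNIV. [:- \<mu> j, 1:]) - s"
  have ds: "degree s < ?n"
  proof -
    have "degree (smult (w k) (\<Prod>j\<in>UNIV-{k}. [:- \<mu> j, 1:])) \<le> ?n - 1" for k
      by (rule order_trans[OF degree_smult_le]) (simp add: degree_prod_linear card_Diff_singleton)
    then have "degree s \<le> ?n - 1"
      unfolding s_def by (intro degree_sum_le) auto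
    then show ?thesis
      using zero_less_card_finite[where 'a='n] by linarith
  qed
  have lead: "coeff (\<Prod>j\<in>UNIV. [:- a j, 1:]) ?n = 1" for a :: "'n \<Rightarrow> real"
  proof -
    have "lead_coeff (\<Prod>j\<in>UNIV. [:- a j, 1:]) = 1"
      by (simp add: lead_coeff_prod)
    then show ?thesis by (simp add: degree_prod_linear)
  qed
  have "p = q"
  proof (rule poly_eqI_degree_lead_coeff[where n = ?n and A = "range \<mu>"])
    show "coeff p ?n = coeff q ?n"
      using ds by (simp add: p_def q_def lead coeff_eq_0)
    show "card (range \<mu>) \<ge> ?n" using inj by (simp add: card_image)
    show "degree p \<le> ?n" by (simp add: p_def degree_prod_linear)
    show "degree q \<le> ?n" unfolding q_def using ds
      by (intro degree_diff_le) (auto simp: degree_prod_linear)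
  next
    fix z assume "z \<in> range \<mu>"
    then obtain k where z: "z = \<mu> k" by auto
    have nz: "(\<Prod>j\<in>UNIV-{k}. \<mu> k - \<mu> j) \<noteq> 0"
      using inj by (auto simp: inj_eq)
    have "poly q z = - (\<Sum>l\<in>UNIV. w l * (\<Prod>j\<in>UNIV-{l}. \<mu> k - \<mu> j))"
      by (auto simp: q_def s_def z poly_prod poly_sum)
    \<comment> \<open>Every summand with \<open>l \<noteq> k\<close> contains the factor
      \<open>\<mu> k - \<mu> k\<close>.\<close>
    also have "(\<Sum>l\<in>UNIV. w l * (\<Prod>j\<in>UNIV-{l}. \<mu> k - \<mu> j)) =
        (\<Sum>l\<in>UNIV. if l = k then w k * (\<Prod>j\<in>UNIV-{k}. \<mu> k - \<mu> j) else 0)"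
      by (intro sum.cong) auto
    also have "\<dots> = w k * (\<Prod>j\<in>UNIV-{k}. \<mu> k - \<mu> j)" by simp
    also have "\<dots> = (\<alpha> k - \<mu> k) * (\<Prod>j\<in>UNIV-{k}. \<mu> k - \<alpha> j)"
      using nz by (simp add: w_def prod_dividef)
    also have "- \<dots> = (\<Prod>j\<in>UNIV. \<mu> k - \<alpha> j)"
      by (subst prod.remove[of UNIV k]) (auto simp flip: mult_minus_left)
    also have "\<dots> = poly p z" by (simp add: p_def z poly_prod)
    finally show "poly p z = poly q z" ..
  qed
  then have "poly p x = poly q x" by simp
  then have e: "(\<Prod>j\<in>UNIV. x - \<alpha> j) =
      (\<Prod>j\<in>UNIV. x - \<mu> j) - (\<Sum>k\<in>UNIV. w k * (\<Prod>j\<in>UNIV-{k}. x - \<mu> j))"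
    by (simp add: p_def q_def s_def poly_prod poly_sum)
  have nz: "(\<Prod>j\<in>UNIV. x - \<mu> j) \<noteq> 0" using ne by simp
  have "w k * (\<Prod>j\<in>UNIV-{k}. x - \<mu> j) = w k / (x - \<mu> k) * (\<Prod>j\<in>UNIV. x - \<mu> j)" for k
    using ne[of k] by (subst prod.remove[of UNIV k]) auto
  then have "(\<Prod>j\<in>UNIV. x - \<alpha> j) =
      (1 - (\<Sum>k\<in>UNIV. w k / (x - \<mu> k))) * (\<Prod>j\<in>UNIV. x - \<mu> j)"
    unfolding e by (simp add: left_diff_distrib sum_distrib_right)
  then show ?thesis using nz unfolding w_def by (metis (no_types, lifting) nonzero_mult_div_cancel_right)
qed

text \<open>Take \<open>v k = sqrt (w k)\<close> with the numerators \<open>w k\<close> of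
  \<open>sum_partial_fractions\<close>. Then row \<open>i\<close> of \<open>V\<close>, proportional
  to \<open>v k / (\<alpha> i - \<mu> k)\<close>, is a unit eigenvector of
  \<open>diag \<mu> + v v^T\<close> for the eigenvalue \<open>\<alpha> i\<close>. Strictness makes
  the \<open>w k\<close> positive and the denominators nonzero.\<close>

lemma strict_interlacing_rank_one:
  fixes \<alpha> \<mu> :: "'n::{finite,linorder} \<Rightarrow> real"
  assumes gt: "\<And>k. \<mu> k < \<alpha> k" and lt: "\<And>k l. k < l \<Longrightarrow> \<alpha> l < \<mu> k"
  shows "\<exists>(V::((real,'n) vec,'n) vec) (v::(real,'n) vec). V ** transpose V = mat 1 \<and>
    (\<forall>k l. (\<Sum>i\<in>UNIV. \<alpha> i * V$i$k * V$i$l) = (if k = l then \<mu> k else 0) + v$k * v$l)"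
proof -
  define w where "w k = (\<alpha> k - \<mu> k) * (\<Prod>j\<in>UNIV-{k}. (\<mu> k - \<alpha> j) / (\<mu> k - \<mu> j))" for k
  have mu: "\<mu> l < \<mu> k" if "k < l" for k l
    using gt[of l] lt[OF that] by linarith
  have inj: "inj \<mu>"
    by (rule injI) (metis mu less_irrefl linorder_neqE)
  \<comment> \<open>Numerator and denominator of each factor have the same sign: both are negative
    for \<open>j < k\<close> and both positive for \<open>j > k\<close>.\<close>
  have wpos: "w k > 0" for k
  proof -
    have "(\<mu> k - \<alpha> j) / (\<mu> k - \<mu> j) > 0" if "j \<noteq> k" for j
    proof (cases "j < k")
      case True
      then show ?thesis using mu[OF True] gt[of j] by (intro divide_neg_neg) linarith+
    next
      case False
      with that have "k < j" by simp
      then show ?thesis using mu[of k j] lt[of k j] by simp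
    qed
    then show ?thesis unfolding w_def using gt[of k]
      by (intro mult_pos_pos prod_pos) auto
  qed
  have ne: "\<alpha> i \<noteq> \<mu> k" for i k
    using gt[of i] gt[of k] lt[of i k] lt[of k i] mu[of i k] by (cases i k rule: linorder_cases) auto
  \<comment> \<open>The secular equation: the left side of \<open>sum_partial_fractions\<close>
    vanishes at \<open>x = \<alpha> i\<close>.\<close>
  have sec: "(\<Sum>k\<in>UNIV. w k / (\<alpha> i - \<mu> k)) = 1" for i
  proof -
    have "(\<Prod>j\<in>UNIV. \<alpha> i - \<alpha> j) = 0" by auto
    then have "0 = 1 - (\<Sum>k\<in>UNIV. w k / (\<alpha> i - \<mu> k))"
      using sum_partial_fractions[OF inj, of "\<alpha> i" \<alpha>, OF ne] by (simp only: w_def div_0)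
    then show ?thesis by simp
  qed
  have ainj: "\<alpha> i \<noteq> \<alpha> j" if "i \<noteq> j" for i j
    using that gt[of i] gt[of j] lt[of i j] lt[of j i] by (cases i j rule: linorder_cases) auto
  define N where "N i = (\<Sum>k\<in>UNIV. w k / (\<alpha> i - \<mu> k)\<^sup>2)" for i
  have Npos: "N i > 0" for i unfolding N_def
    using wpos ne by (intro sum_pos) auto
  define c where "c i = 1 / sqrt (N i)" for i
  define V :: "((real,'n) vec,'n) vec" where "V = (\<chi> i k. c i * sqrt (w k) / (\<alpha> i - \<mu> k))"
  define v :: "(real,'n) vec" where "v = (\<chi> k. sqrt (w k))"
  have sq: "sqrt (w k) * sqrt (w k) = w k" for k using wpos[of k] by simp
  have cN: "c i * c i * N i = 1" for i
    using Npos[of i] by (simp add: c_def)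
  have VVT: "V ** transpose V = mat 1"
  proof -
    have "(\<Sum>k\<in>UNIV. V$i$k * V$j$k) = (if i = j then 1 else 0)" for i j
    proof -
      have "(\<Sum>k\<in>UNIV. V$i$k * V$j$k) = c i * c j * (\<Sum>k\<in>UNIV. w k / ((\<alpha> i - \<mu> k) * (\<alpha> j - \<mu> k)))"
        unfolding sum_distrib_left V_def
        by (intro sum.cong) (use sq in \<open>simp_all add: field_simps\<close>)
      also have "\<dots> = (if i = j then 1 else 0)"
      proof (cases "i = j")
        case True
        then show ?thesis using cN[of i] by (simp add: N_def power2_eq_square)
      next
        case False
        \<comment> \<open>A product of two poles splits into a difference of single poles, and both
          resulting sums are 1 by the secular equation.\<close>
        have "w k / ((\<alpha> i - \<mu> k) * (\<alpha> j - \<mu> k)) =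
            (w k / (\<alpha> i - \<mu> k) - w k / (\<alpha> j - \<mu> k)) / (\<alpha> j - \<alpha> i)" for k
          using ne[of i k] ne[of j k] ainj[of i j] False by (simp add: divide_simps) argo
        then have "(\<Sum>k\<in>UNIV. w k / ((\<alpha> i - \<mu> k) * (\<alpha> j - \<mu> k))) =
            ((\<Sum>k\<in>UNIV. w k / (\<alpha> i - \<mu> k)) - (\<Sum>k\<in>UNIV. w k / (\<alpha> j - \<mu> k))) / (\<alpha> j - \<alpha> i)"
          by (simp add: sum_subtractf flip: sum_divide_distrib)
        with sec False show ?thesis by simp
      qed
      finally show ?thesis .
    qed
    then show ?thesis
      by (simp add: vec_eq_iff matrix_matrix_mult_def transpose_def mat_def)
  qed
  then have "transpose V ** V = mat 1" by (simp add: matrix_left_right_inverse)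
  then have VTV: "(\<Sum>i\<in>UNIV. V$i$k * V$i$l) = (if k = l then 1 else 0)" for k l
    by (simp add: vec_eq_iff matrix_matrix_mult_def transpose_def mat_def)
  \<comment> \<open>The eigenvector equation, in which \<open>c i\<close> must be the scalar product
    of row \<open>i\<close> with \<open>v\<close>; that it is so (\<open>cV\<close>) is the secular
    equation again.\<close>
  have eig: "\<alpha> i * V$i$l = \<mu> l * V$i$l + c i * v$l" for i l
    using ne[of i l] by (simp add: V_def v_def field_simps)
  have cV: "c i = (\<Sum>m\<in>UNIV. V$i$m * v$m)" for i
  proof -
    have "(\<Sum>m\<in>UNIV. V$i$m * v$m) = c i * (\<Sum>m\<in>UNIV. w m / (\<alpha> i - \<mu> m))"
      unfolding sum_distrib_left V_def v_def
      by (intro sum.cong) (use sq in \<open>simp_all add: field_simps\<close>)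
    then show ?thesis using sec by simp
  qed
  have cV2: "(\<Sum>i\<in>UNIV. V$i$k * c i) = v$k" for k
  proof -
    have "(\<Sum>i\<in>UNIV. V$i$k * c i) = (\<Sum>i\<in>UNIV. \<Sum>m\<in>UNIV. V$i$k * V$i$m * v$m)"
      unfolding cV by (simp add: sum_distrib_left mult.assoc)
    also have "\<dots> = (\<Sum>m\<in>UNIV. (\<Sum>i\<in>UNIV. V$i$k * V$i$m) * v$m)"
      by (subst sum.swap) (simp add: sum_distrib_right)
    also have "\<dots> = v$k" by (simp add: VTV if_distrib[of "\<lambda>x. x * _"] cong: if_cong)
    finally show ?thesis .
  qed
  have "(\<Sum>i\<in>UNIV. \<alpha> i * V$i$k * V$i$l) = (if k = l then \<mu> k else 0) + v$k * v$l" for k l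
  proof -
    have "\<alpha> i * V$i$k * V$i$l = \<mu> l * (V$i$k * V$i$l) + V$i$k * c i * v$l" for i
      using eig[of i l] by (metis (no_types, lifting) distrib_left mult.assoc mult.commute)
    then have "(\<Sum>i\<in>UNIV. \<alpha> i * V$i$k * V$i$l) =
        \<mu> l * (\<Sum>i\<in>UNIV. V$i$k * V$i$l) + (\<Sum>i\<in>UNIV. V$i$k * c i) * v$l"
      by (simp add: sum.distrib sum_distrib_left sum_distrib_right)
    then show ?thesis by (simp add: VTV cV2)
  qed
  with VVT show ?thesis by blast
qed

text \<open>The degenerate case is a limit of strict ones: \<open>V\<close> is orthogonal and \<open>v\<close> is controlled by the
  diagonal entries, so a subsequence converges.\<close>

lemma interlacing_rank_one:
  fixes \<alpha> \<mu> :: "'n::{finite,linorder} \<Rightarrow> real"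
  assumes ge: "\<And>k. \<mu> k \<le> \<alpha> k" and le: "\<And>k l. k < l \<Longrightarrow> \<alpha> l \<le> \<mu> k"
  shows "\<exists>(V::((real,'n) vec,'n) vec) (v::(real,'n) vec). V ** transpose V = mat 1 \<and>
    (\<forall>k l. (\<Sum>i\<in>UNIV. \<alpha> i * V$i$k * V$i$l) = (if k = l then \<mu> k else 0) + v$k * v$l)"
proof -
  define r where "r k = real (card {j. j < k})" for k :: 'n
  have r: "r k + 1 \<le> r l" if "k < l" for k l
  proof -
    have "card {j. j < k} < card {j. j < l}"
      using that by (intro psubset_card_mono) auto
    then show ?thesis by (simp add: r_def)
  qed
  define e where "e m = inverse (real (Suc m))" for m
  have e: "e m > 0" "e m \<le> 1" for m by (auto simp: e_def field_simps)
  have elim: "e \<longlonglongrightarrow> 0" unfolding e_def by (rule LIMSEQ_inverse_real_of_nat)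
  \<comment> \<open>The descending chain \<alpha>_1, \<mu>_1, \<alpha>_2, \<mu>_2, ... is shifted by
    \<open>e m\<close> times 1, 0, -1, -2, ..., so every gap becomes strictly positive. One index
    further is two places down the chain, whence \<open>2 * r k\<close>.\<close>
  define a where "a m k = \<alpha> k + (1 - 2 * r k) * e m" for m k
  define b where "b m k = \<mu> k - 2 * r k * e m" for m k
  have "\<exists>p :: ((real,'n) vec,'n) vec \<times> (real,'n) vec. fst p ** transpose (fst p) = mat 1 \<and>
    (\<forall>k l. (\<Sum>i\<in>UNIV. a m i * fst p$i$k * fst p$i$l) = (if k = l then b m k else 0) + snd p$k * snd p$l)" for m
    unfolding split_paired_Ex fst_conv snd_conv
  proof (rule strict_interlacing_rank_one)
    show "b m k < a m k" for k
      using ge[of k] e[of m] by (simp add: a_def b_def algebra_simps)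
    show "a m l < b m k" if "k < l" for k l
    proof -
      have "(r k + 1) * e m \<le> r l * e m" using r[OF that] e[of m] by (intro mult_right_mono) auto
      then show ?thesis using le[OF that] e[of m] by (simp add: a_def b_def algebra_simps)
    qed
  qed
  then have "\<exists>p. \<forall>m. fst (p m) ** transpose (fst (p m)) = mat 1 \<and>
    (\<forall>k l. (\<Sum>i\<in>UNIV. a m i * fst (p m)$i$k * fst (p m)$i$l) =
      (if k = l then b m k else 0) + snd (p m :: ((real,'n) vec,'n) vec \<times> (real,'n) vec)$k * snd (p m)$l)"
    by (intro choice) blast
  then obtain p where p: "\<forall>m. fst (p m) ** transpose (fst (p m)) = mat 1 \<and>
    (\<forall>k l. (\<Sum>i\<in>UNIV. a m i * fst (p m)$i$k * fst (p m)$i$l) =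
      (if k = l then b m k else 0) + snd (p m :: ((real,'n) vec,'n) vec \<times> (real,'n) vec)$k * snd (p m)$l)" ..
  define V where "V m = fst (p m)" for m
  define v where "v m = snd (p m)" for m
  have VV: "V m ** transpose (V m) = mat 1"
    and Vv: "(\<Sum>i\<in>UNIV. a m i * V m$i$k * V m$i$l) = (if k = l then b m k else 0) + v m$k * v m$l" for m k l
    using p unfolding V_def v_def by blast+
  have rows: "(\<Sum>k\<in>UNIV. V m$i$k * V m$j$k) = (if i = j then 1 else 0)" for m i j
    using VV[of m] by (simp add: vec_eq_iff matrix_matrix_mult_def transpose_def mat_def)
  have Vsq: "(V m$i$k)\<^sup>2 \<le> 1" for m i k
  proof -
    have "(V m$i$k)\<^sup>2 \<le> (\<Sum>k\<in>UNIV. (V m$i$k)\<^sup>2)" by (rule member_le_sum) auto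
    also have "\<dots> = 1" using rows[of m i i] by (simp add: power2_eq_square)
    finally show ?thesis .
  qed
  \<comment> \<open>The case \<open>k = l\<close> of \<open>Vv\<close> expresses the square of
    \<open>v m $ k\<close> through \<open>a m\<close>, \<open>b m\<close> and entries of
    \<open>V m\<close> of modulus at most 1; since \<open>e m \<le> 1\<close>, the resulting bound
    does not depend on \<open>m\<close>.\<close>
  define C where "C = (\<Sum>i\<in>UNIV. \<bar>\<alpha> i\<bar> + \<bar>1 - 2 * r i\<bar>) + (\<Sum>i\<in>UNIV. \<bar>\<mu> i\<bar> + \<bar>2 * r i\<bar>)"
  have em: "\<bar>x * e m\<bar> \<le> \<bar>x\<bar>" for x m
    using e[of m] by (simp add: abs_mult mult_left_le)
  have vsq: "(v m$k)\<^sup>2 \<le> C" for m k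
  proof -
    have "(v m$k)\<^sup>2 = (\<Sum>i\<in>UNIV. a m i * (V m$i$k)\<^sup>2) - b m k"
      using Vv[of m k k] by (simp add: power2_eq_square mult.assoc)
    also have "(\<Sum>i\<in>UNIV. a m i * (V m$i$k)\<^sup>2) \<le> (\<Sum>i\<in>UNIV. \<bar>\<alpha> i\<bar> + \<bar>1 - 2 * r i\<bar>)"
    proof (rule sum_mono)
      fix i
      have "a m i * (V m$i$k)\<^sup>2 \<le> \<bar>a m i\<bar> * 1"
        using Vsq[of m i k] by (intro mult_mono) auto
      also have "\<dots> \<le> \<bar>\<alpha> i\<bar> + \<bar>1 - 2 * r i\<bar>"
        unfolding a_def mult_1_right
        by (rule order_trans[OF abs_triangle_ineq]) (use em[of "1 - 2 * r i" m] in simp)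
      finally show "a m i * (V m$i$k)\<^sup>2 \<le> \<bar>\<alpha> i\<bar> + \<bar>1 - 2 * r i\<bar>" .
    qed
    finally have 1: "(v m$k)\<^sup>2 \<le> (\<Sum>i\<in>UNIV. \<bar>\<alpha> i\<bar> + \<bar>1 - 2 * r i\<bar>) - b m k" by simp
    have "- b m k \<le> \<bar>\<mu> k\<bar> + \<bar>2 * r k\<bar>"
      using em[of "2 * r k" m] abs_ge_minus_self[of "\<mu> k"] abs_ge_self[of "2 * r k * e m"]
      unfolding b_def by linarith
    also have "\<bar>\<mu> k\<bar> + \<bar>2 * r k\<bar> \<le> (\<Sum>i\<in>UNIV. \<bar>\<mu> i\<bar> + \<bar>2 * r i\<bar>)"
      by (rule member_le_sum) auto
    finally show ?thesis using 1 unfolding C_def by linarith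
  qed
  have "bounded (range (\<lambda>m. (V m, v m)))"
  proof -
    have "norm (V m$i) \<le> real CARD('n)" for m i
    proof -
      have "norm (V m$i) \<le> (\<Sum>k\<in>UNIV. \<bar>V m$i$k\<bar>)" by (rule norm_le_l1_cart)
      also have "\<dots> \<le> (\<Sum>k\<in>(UNIV::'n set). 1)"
        using Vsq by (intro sum_mono) (simp add: abs_square_le_1)
      finally show ?thesis by simp
    qed
    then have bV: "norm (V m) \<le> (\<Sum>i\<in>(UNIV::'n set). real CARD('n))" for m
      unfolding norm_vec_def[of "V m"]
      by (intro order_trans[OF L2_set_le_sum] sum_mono) auto
    have bv: "norm (v m) \<le> (\<Sum>k\<in>(UNIV::'n set). sqrt C)" for m
      using vsq by (intro order_trans[OF norm_le_l1_cart] sum_mono real_le_rsqrt) auto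
    have "norm (V m, v m) \<le> (\<Sum>i\<in>(UNIV::'n set). real CARD('n)) + (\<Sum>k\<in>(UNIV::'n set). sqrt C)" for m
      using norm_Pair_le[of "V m" "v m"] bV[of m] bv[of m] by linarith
    then show ?thesis by (intro boundedI) auto
  qed
  then obtain L s where s: "strict_mono s" and lim: "((\<lambda>m. (V m, v m)) \<circ> s) \<longlonglongrightarrow> L"
    using bounded_imp_convergent_subsequence by blast
  obtain W w where L: "L = (W, w)" by (cases L)
  have W: "(\<lambda>m. V (s m)) \<longlonglongrightarrow> W" and w: "(\<lambda>m. v (s m)) \<longlonglongrightarrow> w"
    using tendsto_fst[OF lim] tendsto_snd[OF lim] by (simp_all add: L o_def)
  have es: "(\<lambda>m. e (s m)) \<longlonglongrightarrow> 0"
    using LIMSEQ_subseq_LIMSEQ[OF elim s] by (simp add: o_def)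
  have a: "(\<lambda>m. a (s m) k) \<longlonglongrightarrow> \<alpha> k" for k
  proof -
    have "(\<lambda>m. a (s m) k) \<longlonglongrightarrow> \<alpha> k + (1 - 2 * r k) * 0"
      unfolding a_def by (intro tendsto_intros es)
    then show ?thesis by simp
  qed
  have b: "(\<lambda>m. b (s m) k) \<longlonglongrightarrow> \<mu> k" for k
  proof -
    have "(\<lambda>m. b (s m) k) \<longlonglongrightarrow> \<mu> k - 2 * r k * 0"
      unfolding b_def by (intro tendsto_intros es)
    then show ?thesis by simp
  qed
  have Wc: "(\<lambda>m. V (s m)$i$k) \<longlonglongrightarrow> W$i$k" for i k
    by (intro tendsto_vec_nth W)
  have wc: "(\<lambda>m. v (s m)$k) \<longlonglongrightarrow> w$k" for k
    by (intro tendsto_vec_nth w)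
  have "(\<Sum>k\<in>UNIV. W$i$k * W$j$k) = (if i = j then 1 else 0)" for i j
  proof (rule LIMSEQ_unique)
    show "(\<lambda>m. \<Sum>k\<in>UNIV. V (s m)$i$k * V (s m)$j$k) \<longlonglongrightarrow> (\<Sum>k\<in>UNIV. W$i$k * W$j$k)"
      by (intro tendsto_intros Wc)
    show "(\<lambda>m. \<Sum>k\<in>UNIV. V (s m)$i$k * V (s m)$j$k) \<longlonglongrightarrow> (if i = j then 1 else 0)"
      unfolding rows by (rule tendsto_const)
  qed
  then have "W ** transpose W = mat 1"
    by (simp add: vec_eq_iff matrix_matrix_mult_def transpose_def mat_def)
  moreover have "(\<Sum>i\<in>UNIV. \<alpha> i * W$i$k * W$i$l) = (if k = l then \<mu> k else 0) + w$k * w$l" for k l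
  proof (rule LIMSEQ_unique)
    show "(\<lambda>m. \<Sum>i\<in>UNIV. a (s m) i * V (s m)$i$k * V (s m)$i$l) \<longlonglongrightarrow> (\<Sum>i\<in>UNIV. \<alpha> i * W$i$k * W$i$l)"
      by (intro tendsto_intros Wc a)
    have "(\<lambda>m. (if k = l then b (s m) k else 0)) \<longlonglongrightarrow> (if k = l then \<mu> k else 0)"
      using b[of k] by (cases "k = l") auto
    then show "(\<lambda>m. \<Sum>i\<in>UNIV. a (s m) i * V (s m)$i$k * V (s m)$i$l) \<longlonglongrightarrow> (if k = l then \<mu> k else 0) + w$k * w$l"
      unfolding Vv by (intro tendsto_intros wc)
  qed
  ultimately show ?thesis by blast
qed

lemma weighted_norm_adjoint:
  fixes A :: "'n::finite \<Rightarrow> 'n \<Rightarrow> complex" and m :: "'n \<Rightarrow> complex"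
  shows "(\<Sum>k\<in>UNIV. m k * ((\<Sum>i\<in>UNIV. cnj (A i k) * x i) * cnj (\<Sum>i\<in>UNIV. cnj (A i k) * x i))) =
    (\<Sum>i\<in>UNIV. \<Sum>j\<in>UNIV. x i * cnj (x j) * (\<Sum>k\<in>UNIV. m k * A j k * cnj (A i k)))"
proof -
  have "(\<Sum>k\<in>UNIV. m k * ((\<Sum>i\<in>UNIV. cnj (A i k) * x i) * cnj (\<Sum>i\<in>UNIV. cnj (A i k) * x i))) =
    (\<Sum>k\<in>UNIV. \<Sum>i\<in>UNIV. \<Sum>j\<in>UNIV. x i * cnj (x j) * (m k * A j k * cnj (A i k)))"
    by (simp only: cnj_sum sum_product) (simp only: sum_distrib_left complex_cnj_mult complex_cnj_cnj mult_ac)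
  also have "\<dots> = (\<Sum>i\<in>UNIV. \<Sum>k\<in>UNIV. \<Sum>j\<in>UNIV. x i * cnj (x j) * (m k * A j k * cnj (A i k)))"
    by (rule sum.swap)
  also have "\<dots> = (\<Sum>i\<in>UNIV. \<Sum>j\<in>UNIV. \<Sum>k\<in>UNIV. x i * cnj (x j) * (m k * A j k * cnj (A i k)))"
    by (rule sum.cong[OF refl]) (rule sum.swap)
  finally show ?thesis by (simp add: sum_distrib_left)
qed

lemma zero_row_kernel:
  fixes B :: "((complex,'n::finite) vec,'n) vec"
  assumes "row k B = 0"
  shows "\<exists>x. x \<noteq> 0 \<and> B *v x = 0"
proof -
  have "det B = 0" using assms by (rule det_zero_row)
  then have "\<not> (\<exists>C. C ** B = mat 1)"
    using invertible_det_nz invertible_left_inverse by blast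
  then show ?thesis using matrix_left_invertible_ker by blast
qed

text \<open>The test vectors \<open>x\<close> below come from homogeneous systems in \<open>n\<close> unknowns in which the
  equation with index \<open>k\<close> (respectively \<open>l\<close>) is left out; \<open>B\<close> has a zero row in its place.\<close>

lemma interlacing_necessary:
  fixes \<alpha> \<mu> :: "'n::{finite,linorder} \<Rightarrow> real" and A :: "'n \<Rightarrow> 'n \<Rightarrow> complex"
  assumes \<alpha>: "\<And>k l. k \<le> l \<Longrightarrow> \<alpha> l \<le> \<alpha> k" and \<mu>: "\<And>k l. k \<le> l \<Longrightarrow> \<mu> l \<le> \<mu> k"
    and pos: "\<And>k. \<mu> k > 0"
    and diag: "\<And>i j. (\<Sum>k\<in>UNIV. complex_of_real (\<mu> k) * A i k * cnj (A j k)) = (if i = j then complex_of_real (\<alpha> i) else 0)"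
    and unit: "\<And>i j. (\<Sum>k\<in>UNIV. A i k * cnj (A j k)) = (if i = j then 1 else 0) + u i * cnj (u j)"
  shows "\<mu> k \<le> \<alpha> k" and "consecutive k l \<Longrightarrow> \<alpha> l \<le> \<mu> k"
proof -
  define y where "y x k = (\<Sum>i\<in>UNIV. cnj (A i k) * x$i)" for x :: "(complex,'n) vec" and k
  have E1: "(\<Sum>k\<in>UNIV. \<mu> k * (cmod (y x k))\<^sup>2) = (\<Sum>i\<in>UNIV. \<alpha> i * (cmod (x$i))\<^sup>2)" for x
  proof -
    have "complex_of_real (\<Sum>k\<in>UNIV. \<mu> k * (cmod (y x k))\<^sup>2) =
       (\<Sum>k\<in>UNIV. complex_of_real (\<mu> k) * (y x k * cnj (y x k)))"
      by (simp add: complex_norm_square[symmetric] del: of_real_power)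
    also have "\<dots> = (\<Sum>i\<in>UNIV. \<Sum>j\<in>UNIV. x$i * cnj (x$j) * (if j = i then complex_of_real (\<alpha> j) else 0))"
      unfolding y_def weighted_norm_adjoint diag ..
    also have "\<dots> = complex_of_real (\<Sum>i\<in>UNIV. \<alpha> i * (cmod (x$i))\<^sup>2)"
      by (simp add: if_distrib[of "\<lambda>z. _ * z"] complex_norm_square[symmetric] mult.commute del: of_real_power cong: if_cong)
    finally show ?thesis by (simp only: of_real_eq_iff)
  qed
  have E2: "(\<Sum>k\<in>UNIV. (cmod (y x k))\<^sup>2) = (\<Sum>i\<in>UNIV. (cmod (x$i))\<^sup>2) + (cmod (\<Sum>i\<in>UNIV. cnj (u i) * x$i))\<^sup>2" for x
  proof -
    have "complex_of_real (\<Sum>k\<in>UNIV. (cmod (y x k))\<^sup>2) = (\<Sum>k\<in>UNIV. 1 * (y x k * cnj (y x k)))"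
      by (simp add: complex_norm_square[symmetric] del: of_real_power)
    also have "\<dots> = (\<Sum>i\<in>UNIV. \<Sum>j\<in>UNIV. x$i * cnj (x$j) * ((if j = i then 1 else 0) + u j * cnj (u i)))"
      unfolding y_def weighted_norm_adjoint using unit by simp
    also have "\<dots> = (\<Sum>i\<in>UNIV. x$i * cnj (x$i)) + (\<Sum>i\<in>UNIV. cnj (u i) * x$i) * cnj (\<Sum>i\<in>UNIV. cnj (u i) * x$i)"
    proof -
      have "(\<Sum>i\<in>UNIV. cnj (u i) * x$i) * cnj (\<Sum>i\<in>UNIV. cnj (u i) * x$i) =
          (\<Sum>i\<in>UNIV. \<Sum>j\<in>UNIV. x$i * cnj (x$j) * (u j * cnj (u i)))"
        unfolding cnj_sum sum_product by (intro sum.cong refl) (simp add: mult_ac)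
      then show ?thesis
        by (simp add: distrib_left sum.distrib if_distrib[of "\<lambda>z. _ * z"] cong: if_cong)
    qed
    also have "\<dots> = complex_of_real ((\<Sum>i\<in>UNIV. (cmod (x$i))\<^sup>2) + (cmod (\<Sum>i\<in>UNIV. cnj (u i) * x$i))\<^sup>2)"
      by (simp only: complex_norm_square[symmetric] of_real_add of_real_sum)
    finally show ?thesis by (simp only: of_real_eq_iff)
  qed
  have xpos: "(\<Sum>i\<in>UNIV. (cmod (x$i))\<^sup>2) > 0" if x0: "x \<noteq> 0" for x :: "(complex,'n) vec"
  proof -
    obtain i where "x$i \<noteq> 0" using x0 by (auto simp: vec_eq_iff)
    then show ?thesis by (intro sum_pos2[where i = i]) auto
  qed
  show "\<mu> k \<le> \<alpha> k"
  proof -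
    \<comment> \<open>The system confines \<open>x\<close> to indices at least \<open>k\<close>,
      where \<alpha> is at most \<open>\<alpha> k\<close>, and \<open>y x\<close> to indices at most
      \<open>k\<close>, where \<mu> is at least \<open>\<mu> k\<close>. Since \<open>E2\<close>
      gives \<open>|x|^2 \<le> |y|^2\<close>, the chain
      \<open>\<mu> k |x|^2 \<le> \<mu> k |y|^2 \<le> \<alpha> k |x|^2\<close> follows through
      \<open>E1\<close>.\<close>
    define B :: "((complex,'n) vec,'n) vec"
      where "B = (\<chi> i j. if i < k then (if i = j then 1 else 0) else if k < i then cnj (A j i) else 0)"
    have "row k B = 0" by (simp add: vec_eq_iff row_def B_def)
    then obtain x where x0: "x \<noteq> 0" and Bx: "B *v x = 0" using zero_row_kernel by blast
    have x: "x$j = 0" if "j < k" for j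
    proof -
      have "(B *v x)$j = x$j" using that
        by (simp add: matrix_vector_mult_def B_def if_distrib[of "\<lambda>z. z * _"] cong: if_cong)
      with Bx show ?thesis by simp
    qed
    have yz: "y x j = 0" if "k < j" for j
    proof -
      have "(B *v x)$j = y x j" using that less_not_sym[OF that]
        by (simp add: matrix_vector_mult_def B_def y_def)
      with Bx show ?thesis by simp
    qed
    have "\<mu> k * (\<Sum>i\<in>UNIV. (cmod (x$i))\<^sup>2) \<le> \<mu> k * (\<Sum>j\<in>UNIV. (cmod (y x j))\<^sup>2)"
      unfolding E2 using pos[of k] by (intro mult_left_mono) auto
    also have "\<dots> \<le> (\<Sum>j\<in>UNIV. \<mu> j * (cmod (y x j))\<^sup>2)"
      unfolding sum_distrib_left
    proof (rule sum_mono)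
      fix j show "\<mu> k * (cmod (y x j))\<^sup>2 \<le> \<mu> j * (cmod (y x j))\<^sup>2"
        using \<mu>[of j k] yz[of j] by (cases "k < j") (auto intro: mult_right_mono)
    qed
    also have "\<dots> \<le> \<alpha> k * (\<Sum>i\<in>UNIV. (cmod (x$i))\<^sup>2)"
      unfolding E1 sum_distrib_left
    proof (rule sum_mono)
      fix j show "\<alpha> j * (cmod (x$j))\<^sup>2 \<le> \<alpha> k * (cmod (x$j))\<^sup>2"
        using \<alpha>[of k j] x[of j] by (cases "j < k") (auto intro: mult_right_mono)
    qed
    finally show ?thesis using xpos[OF x0] by simp
  qed
  show "\<alpha> l \<le> \<mu> k" if c: "consecutive k l"
  proof -
    from c have kl: "k < l" and nb: "j \<le> k \<or> l \<le> j" for j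
      unfolding consecutive_def by (auto simp flip: not_less)
    \<comment> \<open>The supports are reversed: \<open>x\<close> is confined to indices at most
      \<open>l\<close> and \<open>y x\<close> to indices at least \<open>k\<close>. Orthogonality of
      \<open>x\<close> to \<open>u\<close> is placed in row \<open>k\<close> and upgrades
      \<open>E2\<close> to \<open>|y| = |x|\<close>. For consecutive \<open>k\<close> and
      \<open>l\<close> these are \<open>n - 1\<close> equations.\<close>
    define B :: "((complex,'n) vec,'n) vec"
      where "B = (\<chi> i j. if l < i then (if i = j then 1 else 0) else if i < k then cnj (A j i)
        else if i = k then cnj (u j) else 0)"
    have "row l B = 0" using kl less_not_sym[OF kl] by (simp add: vec_eq_iff row_def B_def)
    then obtain x where x0: "x \<noteq> 0" and Bx: "B *v x = 0" using zero_row_kernel by blast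
    have x: "x$j = 0" if "l < j" for j
    proof -
      have "(B *v x)$j = x$j" using that
        by (simp add: matrix_vector_mult_def B_def if_distrib[of "\<lambda>z. z * _"] cong: if_cong)
      with Bx show ?thesis by simp
    qed
    have yz: "y x j = 0" if "j < k" for j
    proof -
      have "(B *v x)$j = y x j" using that less_trans[OF that kl, THEN less_not_sym]
        by (simp add: matrix_vector_mult_def B_def y_def)
      with Bx show ?thesis by simp
    qed
    have ux: "(\<Sum>i\<in>UNIV. cnj (u i) * x$i) = 0"
    proof -
      have "(B *v x)$k = (\<Sum>i\<in>UNIV. cnj (u i) * x$i)" using less_not_sym[OF kl]
        by (simp add: matrix_vector_mult_def B_def)
      with Bx show ?thesis by simp
    qed
    have "\<alpha> l * (\<Sum>i\<in>UNIV. (cmod (x$i))\<^sup>2) \<le> (\<Sum>i\<in>UNIV. \<alpha> i * (cmod (x$i))\<^sup>2)"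
      unfolding sum_distrib_left
    proof (rule sum_mono)
      fix j show "\<alpha> l * (cmod (x$j))\<^sup>2 \<le> \<alpha> j * (cmod (x$j))\<^sup>2"
        using \<alpha>[of j l] x[of j] by (cases "l < j") (auto intro: mult_right_mono)
    qed
    also have "\<dots> \<le> \<mu> k * (\<Sum>j\<in>UNIV. (cmod (y x j))\<^sup>2)"
      unfolding E1[symmetric] sum_distrib_left
    proof (rule sum_mono)
      fix j show "\<mu> j * (cmod (y x j))\<^sup>2 \<le> \<mu> k * (cmod (y x j))\<^sup>2"
        using \<mu>[of k j] yz[of j] by (cases "j < k") (auto intro: mult_right_mono)
    qed
    also have "\<dots> = \<mu> k * (\<Sum>i\<in>UNIV. (cmod (x$i))\<^sup>2)" unfolding E2 ux by simp
    finally show ?thesis using xpos[OF x0] by simp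
  qed
qed

section \<open>The group \<open>SU(n,1)\<close>\<close>

text \<open>This is U(n,1) for \<open>J = I_n1\<close> and a unitary group for
  \<open>J = mat 1\<close>, so one computation of inverses and Lie algebras serves
  \<open>SU_n1\<close>, \<open>K_grp\<close> and \<open>unitary_group\<close>. Determinant
  conditions are handled apart.\<close>

definition form_group :: "((complex,'m::finite) vec,'m) vec \<Rightarrow> ((complex,'m) vec,'m) vec set" where
  "form_group J = {M. conj_transpose M ** J ** M = J}"

lemma conj_transpose_nth [simp]: "conj_transpose M $ i $ j = cnj (M $ j $ i)"
  by (simp add: conj_transpose_def)

lemma conj_transpose_mult: "conj_transpose (A ** B) = conj_transpose B ** conj_transpose A"
  by (simp add: vec_eq_iff matrix_matrix_mult_def mult.commute)

lemma conj_transpose_conj_transpose [simp]: "conj_transpose (conj_transpose A) = A"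
  by (simp add: vec_eq_iff)

lemma conj_transpose_mat_1 [simp]: "conj_transpose (mat 1) = mat 1"
  by (simp add: vec_eq_iff mat_def)

lemma det_conj_transpose: "det (conj_transpose A) = cnj (det A)"
proof -
  have "det (conj_transpose A) = det (\<chi> i j. cnj (A $ i $ j))"
    by (subst det_transpose[symmetric]) (simp add: transpose_def conj_transpose_def)
  also have "\<dots> = cnj (det A)" by (simp add: det_def)
  finally show ?thesis .
qed

lemma sum_UNIV_option: "(\<Sum>x\<in>UNIV. f x) = f None + (\<Sum>k\<in>(UNIV::'n::finite set). f (Some k))"
  by (simp add: UNIV_option_conv sum.reindex o_def)

lemma prod_UNIV_option: "(\<Prod>x\<in>UNIV. f x) = f None * (\<Prod>k\<in>(UNIV::'n::finite set). f (Some k))"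
  by (simp add: UNIV_option_conv prod.reindex o_def)

lemma mult_I_n1_nth [simp]:
  "(M ** I_n1) $ p $ q = (if q = None then - M $ p $ q else M $ p $ q)"
  "(I_n1 ** M) $ p $ q = (if p = None then - M $ p $ q else M $ p $ q)"
  by (simp_all add: matrix_matrix_mult_def I_n1_def if_distrib[of "\<lambda>z. _ * z"] if_distrib[of "\<lambda>z. z * _"] cong: if_cong)

lemma I_n1_mult_I_n1: "I_n1 ** I_n1 = mat 1"
  by (simp add: vec_eq_iff) (simp add: I_n1_def mat_def)

lemma conj_transpose_I_n1: "conj_transpose I_n1 = I_n1"
  by (simp add: vec_eq_iff I_n1_def)

lemma det_I_n1: "det I_n1 = - 1"
  by (subst det_diagonal) (simp_all add: I_n1_def prod_UNIV_option)

lemma form_group_mult: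
  assumes "A \<in> form_group J" "B \<in> form_group J"
  shows "A ** B \<in> form_group J"
proof -
  have "conj_transpose (A ** B) ** J ** (A ** B) = conj_transpose B ** (conj_transpose A ** J ** A) ** B"
    by (simp add: conj_transpose_mult matrix_mul_assoc)
  then show ?thesis using assms by (simp add: form_group_def)
qed

lemma mat_1_in_form_group: "mat 1 \<in> form_group J"
  by (simp add: form_group_def)

lemma form_group_inverse:
  assumes "J ** J = mat 1" "M \<in> form_group J"
  shows "(J ** conj_transpose M ** J) ** M = mat 1" "M ** (J ** conj_transpose M ** J) = mat 1"
proof -
  have "(J ** conj_transpose M ** J) ** M = J ** (conj_transpose M ** J ** M)"
    by (simp add: matrix_mul_assoc)
  then show 1: "(J ** conj_transpose M ** J) ** M = mat 1"
    using assms by (simp add: form_group_def)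
  then show "M ** (J ** conj_transpose M ** J) = mat 1"
    by (simp add: matrix_left_right_inverse)
qed

lemma form_group_matrix_inv:
  assumes "J ** J = mat 1" "M \<in> form_group J"
  shows "matrix_inv M = J ** conj_transpose M ** J"
proof -
  let ?N = "J ** conj_transpose M ** J"
  have "M ** matrix_inv M = mat 1"
    unfolding matrix_inv_def
    by (rule someI2[where a = ?N]) (use form_group_inverse[OF assms] in auto)
  then have "?N ** (M ** matrix_inv M) = ?N" by simp
  then show ?thesis
    by (simp add: matrix_mul_assoc form_group_inverse[OF assms])
qed

text \<open>The inverse \<open>J M* J\<close> is two-sided, so the relations between columns pass to
  rows. For \<open>I_n1\<close> the upper left block of this identity is
  \<open>A A* = 1 + u u*\<close> with \<open>u\<close> the top of the last column, as
  \<open>interlacing_necessary\<close> requires.\<close>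

lemma form_group_row:
  assumes "J ** J = mat 1" "M \<in> form_group J"
  shows "M ** J ** conj_transpose M = J"
proof -
  have "M ** J ** conj_transpose M = (M ** (J ** conj_transpose M ** J)) ** J"
    using assms(1) by (simp flip: matrix_mul_assoc)
  then show ?thesis using form_group_inverse[OF assms] by simp
qed

lemma SU_n1_eq: "SU_n1 = {M \<in> form_group I_n1. det M = 1}"
  by (auto simp: SU_n1_def form_group_def)

lemma unitary_group_eq: "unitary_group = form_group (mat 1)"
  by (auto simp: unitary_group_def form_group_def)

lemma form_group_I_n1_det:
  assumes "M \<in> form_group I_n1"
  shows "cnj (det M) * det M = 1"
proof -
  have "det (conj_transpose M ** I_n1 ** M) = - 1"
    using assms by (simp add: form_group_def det_I_n1)
  then show ?thesis by (simp add: det_mul det_conj_transpose det_I_n1)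
qed

section \<open>Normalizing the determinant and completing a block to an element of SU(n,1)\<close>

lemma block_diag_nth [simp]:
  "block_diag A d $ Some a $ Some b = A $ a $ b"
  "block_diag A d $ None $ None = d"
  "block_diag A d $ Some a $ None = 0"
  "block_diag A d $ None $ Some b = 0"
  by (simp_all add: block_diag_def)

lemma block_diag_mat_1_mult [simp]:
  "(M ** block_diag (mat 1) d) $ p $ q = (if q = None then M $ p $ q * d else M $ p $ q)"
  by (cases q) (simp_all add: matrix_matrix_mult_def sum_UNIV_option mat_def if_distrib[of "\<lambda>z. _ * z"] cong: if_cong)

lemma vec_eq_option_iff:
  "A = B \<longleftrightarrow> A$None = B$None \<and> (\<forall>k. A $ Some k = B $ Some k)"
  by (metis not_None_eq vec_eq_iff)

lemma I_n1_nth [simp]: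
  "I_n1 $ Some a $ Some b = (if a = b then 1 else 0)"
  "I_n1 $ None $ None = - 1"
  "I_n1 $ Some a $ None = 0"
  "I_n1 $ None $ Some b = 0"
  by (simp_all add: I_n1_def)

lemma mult_I_n1_mult_nth:
  fixes A B :: "('n::finite) cmat"
  shows "(A ** I_n1 ** B) $ p $ q = (\<Sum>k\<in>UNIV. A $ p $ Some k * B $ Some k $ q) - A $ p $ None * B $ None $ q"
  by (simp add: matrix_matrix_mult_def[of "A ** I_n1"] sum_UNIV_option)

lemma det_block_diag_mat_1: "det (block_diag (mat 1) d) = d"
proof (subst det_diagonal)
  show "block_diag (mat 1) d $ i $ j = 0" if "i \<noteq> j" for i j
    using that by (cases i; cases j) (auto simp: mat_def)
qed (simp add: prod_UNIV_option mat_def)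

lemma block_diag_mat_1_in_form_group:
  assumes "cnj d * d = 1"
  shows "block_diag (mat 1) d \<in> form_group I_n1"
  using assms unfolding form_group_def
  by (simp add: vec_eq_option_iff mult_I_n1_mult_nth mat_def if_distrib[of "\<lambda>z. _ * z"] cong: if_cong)

text \<open>The determinant is a phase. Multiplying the last column by its inverse preserves the
  form and leaves the upper left block untouched.\<close>

lemma normalize_det:
  assumes "M \<in> form_group I_n1"
  shows "M ** block_diag (mat 1) (inverse (det M)) \<in> SU_n1"
proof -
  have d: "cnj (det M) * det M = 1" by (rule form_group_I_n1_det[OF assms])
  then have nz: "det M \<noteq> 0" by auto
  have "cnj (inverse (det M)) * inverse (det M) = 1"
    using d by (simp flip: inverse_mult_distrib)
  from form_group_mult[OF assms block_diag_mat_1_in_form_group[OF this]] nz show ?thesis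
    unfolding SU_n1_eq by (simp add: det_mul det_block_diag_mat_1)
qed

text \<open>The missing last column is \<open>(A w, W) / sqrt W\<close> with \<open>W = 1 + |w|\<^sup>2\<close>, up to the phase that
  normalizes the determinant.\<close>

lemma SU_n1_extension:
  fixes A :: "'n::finite \<Rightarrow> 'n \<Rightarrow> real"
  assumes "\<And>k l. (\<Sum>i\<in>UNIV. A i k * A i l) = (if k = l then 1 else 0) + w k * w l"
  shows "\<exists>g\<in>SU_n1. \<forall>i k. g $ Some i $ Some k = complex_of_real (A i k)"
proof -
  define W where "W = 1 + (\<Sum>k\<in>UNIV. w k * w k)"
  have W: "W > 0" unfolding W_def by (intro add_pos_nonneg sum_nonneg) auto
  define z where "z i = (\<Sum>k\<in>UNIV. A i k * w k) / sqrt W" for i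
  have Az: "(\<Sum>i\<in>UNIV. A i k * z i) = w k * sqrt W" for k
  proof -
    have "(\<Sum>i\<in>UNIV. A i k * z i) = (\<Sum>i\<in>UNIV. \<Sum>l\<in>UNIV. A i k * A i l * w l) / sqrt W"
      by (simp add: z_def sum_distrib_left sum_divide_distrib mult.assoc)
    also have "(\<Sum>i\<in>UNIV. \<Sum>l\<in>UNIV. A i k * A i l * w l) = (\<Sum>l\<in>UNIV. (\<Sum>i\<in>UNIV. A i k * A i l) * w l)"
      by (subst sum.swap) (simp add: sum_distrib_right)
    also have "\<dots> = w k * W" unfolding assms W_def
      by (simp add: distrib_right sum.distrib if_distrib[of "\<lambda>z. z * _"] sum_distrib_left mult.assoc distrib_left cong: if_cong)
    also have "w k * W / sqrt W = w k * sqrt W"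
      using W by (metis real_div_sqrt less_imp_le times_divide_eq_right)
    finally show ?thesis .
  qed
  \<comment> \<open>By \<open>Az\<close> the sum of the \<open>z i * z i\<close> equals the sum of
    the \<open>w k * w k\<close>, which is \<open>W - 1\<close>.\<close>
  have zz: "(\<Sum>i\<in>UNIV. z i * z i) - sqrt W * sqrt W = - 1"
  proof -
    have "(\<Sum>i\<in>UNIV. z i * z i) = (\<Sum>i\<in>UNIV. \<Sum>k\<in>UNIV. w k * (A i k * z i)) / sqrt W"
      by (subst (2) z_def) (simp add: sum_distrib_left sum_divide_distrib mult_ac)
    also have "(\<Sum>i\<in>UNIV. \<Sum>k\<in>UNIV. w k * (A i k * z i)) = (\<Sum>k\<in>UNIV. w k * (w k * sqrt W))"
      by (subst sum.swap) (simp add: Az flip: sum_distrib_left)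
    also have "\<dots> / sqrt W = W - 1"
      using W by (simp add: W_def flip: sum_distrib_right mult.assoc)
    finally show ?thesis using W by simp
  qed
  define g :: "'n cmat" where
    "g = (\<chi> p q. complex_of_real (case p of
         Some i \<Rightarrow> (case q of Some k \<Rightarrow> A i k | None \<Rightarrow> z i)
       | None \<Rightarrow> (case q of Some k \<Rightarrow> w k | None \<Rightarrow> sqrt W)))"
  have g: "g $ Some i $ Some k = of_real (A i k)" "g $ None $ Some k = of_real (w k)"
    "g $ Some i $ None = of_real (z i)" "g $ None $ None = of_real (sqrt W)" for i k
    by (simp_all add: g_def)
  have "conj_transpose g ** I_n1 ** g = I_n1"
    unfolding vec_eq_iff
  proof (intro allI)
    fix p q
    have e: "(conj_transpose g ** I_n1 ** g) $ p $ q =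
        (\<Sum>k\<in>UNIV. cnj (g $ Some k $ p) * g $ Some k $ q) - cnj (g $ None $ p) * g $ None $ q"
      by (simp add: mult_I_n1_mult_nth)
    show "(conj_transpose g ** I_n1 ** g) $ p $ q = I_n1 $ p $ q"
      unfolding e using assms Az zz
      by (cases p; cases q)
        (simp_all add: g mult.commute flip: of_real_mult of_real_sum of_real_diff del: real_sqrt_mult_self)
  qed
  then have "g \<in> form_group I_n1" by (simp add: form_group_def)
  from normalize_det[OF this] show ?thesis
    by (rule bexI[rotated]) (simp add: g)
qed

text \<open>Put \<open>A = \<alpha>^(1/2) V \<mu>^(-1/2)\<close> with the orthogonal
  \<open>V\<close> of \<open>interlacing_rank_one\<close>. Orthogonality gives
  \<open>A \<mu> A* = \<alpha>\<close>, and \<open>V^T \<alpha> V = \<mu> + v v^T\<close> gives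
  \<open>A^T A = 1 + w w^T\<close> with \<open>w = \<mu>^(-1/2) v\<close>, which is what
  \<open>SU_n1_extension\<close> completes to a group element.\<close>

theorem SU_n1_interlacing:
  fixes \<alpha> \<mu> :: "'n::{finite,linorder} \<Rightarrow> real"
  assumes pos: "\<And>k. \<mu> k > 0" and ge: "\<And>k. \<mu> k \<le> \<alpha> k" and le: "\<And>k l. k < l \<Longrightarrow> \<alpha> l \<le> \<mu> k"
  shows "\<exists>g\<in>SU_n1. \<forall>i j. (\<Sum>k\<in>UNIV. complex_of_real (\<mu> k) * g $ Some i $ Some k * cnj (g $ Some j $ Some k)) =
    (if i = j then complex_of_real (\<alpha> i) else 0)"
proof -
  obtain V :: "((real,'n) vec,'n) vec" and v :: "(real,'n) vec" where VV: "V ** transpose V = mat 1"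
    and Vv: "\<And>k l. (\<Sum>i\<in>UNIV. \<alpha> i * V$i$k * V$i$l) = (if k = l then \<mu> k else 0) + v$k * v$l"
    using interlacing_rank_one[of \<mu> \<alpha>, OF ge le] by auto
  have apos: "\<alpha> i > 0" for i using pos[of i] ge[of i] by linarith
  have sa: "sqrt (\<alpha> i) * sqrt (\<alpha> i) = \<alpha> i" and sm: "sqrt (\<mu> i) * sqrt (\<mu> i) = \<mu> i" for i
    using pos[of i] apos[of i] by simp_all
  define A where "A i k = sqrt (\<alpha> i) * V$i$k / sqrt (\<mu> k)" for i k
  define w where "w k = v$k / sqrt (\<mu> k)" for k
  have "(\<Sum>i\<in>UNIV. A i k * A i l) = (if k = l then 1 else 0) + w k * w l" for k l
  proof -
    have "A i k * A i l = \<alpha> i * V$i$k * V$i$l / (sqrt (\<mu> k) * sqrt (\<mu> l))" for i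
      using sa[of i] by (simp add: A_def mult_ac)
    then have "(\<Sum>i\<in>UNIV. A i k * A i l) = (\<Sum>i\<in>UNIV. \<alpha> i * V$i$k * V$i$l) / (sqrt (\<mu> k) * sqrt (\<mu> l))"
      by (simp add: sum_divide_distrib)
    also have "\<dots> = (if k = l then 1 else 0) + w k * w l"
      unfolding Vv w_def using pos[of l] by (auto simp: add_divide_distrib)
    finally show ?thesis .
  qed
  from SU_n1_extension[OF this] obtain g where g: "g \<in> SU_n1"
    "\<And>i k. g $ Some i $ Some k = complex_of_real (A i k)" by blast
  have "(\<Sum>k\<in>UNIV. \<mu> k * A i k * A j k) = (if i = j then \<alpha> i else 0)" for i j
  proof -
    have "\<mu> k * A i k * A j k = sqrt (\<alpha> i) * sqrt (\<alpha> j) * (V$i$k * V$j$k)" for k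
      using sm[of k] pos[of k] by (simp add: A_def field_simps)
    then have "(\<Sum>k\<in>UNIV. \<mu> k * A i k * A j k) = sqrt (\<alpha> i) * sqrt (\<alpha> j) * (\<Sum>k\<in>UNIV. V$i$k * V$j$k)"
      by (simp add: sum_distrib_left)
    moreover have "(\<Sum>k\<in>UNIV. V$i$k * V$j$k) = (if i = j then 1 else 0)"
      using VV by (simp add: vec_eq_iff matrix_matrix_mult_def transpose_def mat_def)
    ultimately show ?thesis using sa by simp
  qed
  then have "(\<Sum>k\<in>UNIV. complex_of_real (\<mu> k) * g $ Some i $ Some k * cnj (g $ Some j $ Some k)) =
    (if i = j then complex_of_real (\<alpha> i) else 0)" for i j
    by (simp add: g flip: of_real_mult of_real_sum)
  with g(1) show ?thesis by blast
qed

section \<open>Lie algebras\<close>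

lemma bounded_bilinear_matrix_mult:
  "bounded_bilinear ((**) :: complex^'m^'m \<Rightarrow> complex^'m^'m \<Rightarrow> complex^'m^'m)"
  unfolding bilinear_conv_bounded_bilinear[symmetric] bilinear_def linear_iff
  by (auto simp: vec_eq_iff matrix_matrix_mult_def sum.distrib algebra_simps scaleR_sum_right)

lemmas has_vector_derivative_matrix_mult =
  bounded_bilinear.has_vector_derivative[OF bounded_bilinear_matrix_mult]

lemma bounded_linear_conj_transpose: "bounded_linear conj_transpose"
  unfolding linear_conv_bounded_linear[symmetric] linear_iff by (auto simp: vec_eq_iff)

lemma bounded_linear_block_diag:
  "bounded_linear (\<lambda>p. block_diag (fst p) (snd p))"
  unfolding linear_conv_bounded_linear[symmetric] linear_iff
  by (auto simp: vec_eq_option_iff)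

lemma has_vector_derivative_nth:
  assumes "(\<gamma> has_vector_derivative X) F"
  shows "((\<lambda>t. \<gamma> t $ i $ j) has_vector_derivative X $ i $ j) F"
  by (intro bounded_linear.has_vector_derivative[OF bounded_linear_vec_nth] assms)

text \<open>Carrying the velocity as a function of time lets product and chain rules be applied to
  whole curves.\<close>

lemma lie_algebra_iff:
  "X \<in> lie_algebra H \<longleftrightarrow> (\<exists>\<gamma> \<gamma>'. (\<forall>t. \<gamma> t \<in> H) \<and> (\<forall>t. (\<gamma> has_vector_derivative \<gamma>' t) (at t)) \<and>
     \<gamma> 0 = mat 1 \<and> \<gamma>' 0 = X)"
proof
  assume "X \<in> lie_algebra H"
  then obtain \<gamma> where "\<forall>t. \<gamma> t \<in> H" "\<forall>t. \<gamma> differentiable (at t)" "\<gamma> 0 = mat 1" "(\<gamma> has_vector_derivative X) (at 0)"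
    unfolding lie_algebra_def by blast
  moreover from this have "\<forall>t. (\<gamma> has_vector_derivative vector_derivative \<gamma> (at t)) (at t)"
    "vector_derivative \<gamma> (at 0) = X"
    by (auto simp: vector_derivative_works intro: vector_derivative_at)
  ultimately show "\<exists>\<gamma> \<gamma>'. (\<forall>t. \<gamma> t \<in> H) \<and> (\<forall>t. (\<gamma> has_vector_derivative \<gamma>' t) (at t)) \<and>
     \<gamma> 0 = mat 1 \<and> \<gamma>' 0 = X"
    by (intro exI[of _ \<gamma>] exI[of _ "\<lambda>t. vector_derivative \<gamma> (at t)"]) auto
next
  assume "\<exists>\<gamma> \<gamma>'. (\<forall>t. \<gamma> t \<in> H) \<and> (\<forall>t. (\<gamma> has_vector_derivative \<gamma>' t) (at t)) \<and>
     \<gamma> 0 = mat 1 \<and> \<gamma>' 0 = X"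
  then show "X \<in> lie_algebra H"
    unfolding lie_algebra_def by (auto intro: differentiableI_vector)
qed

lemma lie_algebraI:
  assumes "\<And>t. \<gamma> t \<in> H" "\<And>t. (\<gamma> has_vector_derivative \<gamma>' t) (at t)" "\<gamma> 0 = mat 1" "\<gamma>' 0 = X"
  shows "X \<in> lie_algebra H"
  using assms lie_algebra_iff by blast

lemma lie_algebraE:
  assumes "X \<in> lie_algebra H"
  obtains \<gamma> \<gamma>' where "\<And>t. \<gamma> t \<in> H" "\<And>t. (\<gamma> has_vector_derivative \<gamma>' t) (at t)" "\<gamma> 0 = mat 1" "\<gamma>' 0 = X"
  using assms lie_algebra_iff by blast

lemma lie_algebra_mono: "H \<subseteq> H' \<Longrightarrow> lie_algebra H \<subseteq> lie_algebra H'"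
  unfolding lie_algebra_def by blast

text \<open>Sums are velocities of products of curves through the identity, and real multiples come
  from rescaling time. Negatives are the case of reversed time, so closure under products is
  enough.\<close>

lemma subspace_lie_algebra:
  assumes 1: "mat 1 \<in> H" and mult: "\<And>A B. A \<in> H \<Longrightarrow> B \<in> H \<Longrightarrow> A ** B \<in> H"
  shows "subspace (lie_algebra H)"
  unfolding subspace_def
proof (intro conjI ballI allI)
  show "0 \<in> lie_algebra H"
    by (rule lie_algebraI[where \<gamma> = "\<lambda>_. mat 1" and \<gamma>' = "\<lambda>_. 0"]) (auto simp: 1)
next
  fix X Y assume "X \<in> lie_algebra H" "Y \<in> lie_algebra H"
  then obtain \<gamma> \<gamma>' \<delta> \<delta>' where
    g: "\<And>t. \<gamma> t \<in> H" "\<And>t. (\<gamma> has_vector_derivative \<gamma>' t) (at t)" "\<gamma> 0 = mat 1" "\<gamma>' 0 = X" and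
    d: "\<And>t. \<delta> t \<in> H" "\<And>t. (\<delta> has_vector_derivative \<delta>' t) (at t)" "\<delta> 0 = mat 1" "\<delta>' 0 = Y"
    by (metis lie_algebraE)
  show "X + Y \<in> lie_algebra H"
    by (rule lie_algebraI[where \<gamma> = "\<lambda>t. \<gamma> t ** \<delta> t", OF _ has_vector_derivative_matrix_mult[OF g(2) d(2)]])
      (auto simp: g d mult)
next
  fix c X assume "X \<in> lie_algebra H"
  then obtain \<gamma> \<gamma>' where
    g: "\<And>t. \<gamma> t \<in> H" "\<And>t. (\<gamma> has_vector_derivative \<gamma>' t) (at t)" "\<gamma> 0 = mat 1" "\<gamma>' 0 = X"
    by (metis lie_algebraE)
  have "((\<gamma> \<circ> (\<lambda>t. c * t)) has_vector_derivative c *\<^sub>R \<gamma>' (c * t)) (at t)" for t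
    by (rule vector_diff_chain_at) (auto intro!: derivative_eq_intros g(2))
  then show "c *\<^sub>R X \<in> lie_algebra H"
    by (rule lie_algebraI[rotated]) (auto simp: g)
qed

definition smul :: "complex \<Rightarrow> complex^'m^'m \<Rightarrow> complex^'m^'m" where
  "smul a A = (\<chi> i j. a * A $ i $ j)"

lemma smul_nth [simp]: "smul a A $ i $ j = a * A $ i $ j"
  by (simp add: smul_def)

lemma smul_mult: "smul a A ** B = smul a (A ** B)" "A ** smul a B = smul a (A ** B)"
  by (simp_all add: vec_eq_iff matrix_matrix_mult_def sum_distrib_left mult_ac)

lemma conj_transpose_smul: "conj_transpose (smul a A) = smul (cnj a) (conj_transpose A)"
  by (simp add: vec_eq_iff)

lemma smul_smul: "smul a (smul b A) = smul (a * b) A"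
  by (simp add: vec_eq_iff)

lemma conj_transpose_add: "conj_transpose (A + B) = conj_transpose A + conj_transpose B"
  by (simp add: vec_eq_iff)

lemma matrix_add_mult:
  fixes A B C :: "complex^'m^'m"
  shows "(A + B) ** C = A ** C + B ** C"
  by (simp add: vec_eq_iff matrix_matrix_mult_def sum.distrib distrib_right)

lemma smul_add: "smul a (A + B) = smul a A + smul a B"
  by (simp add: vec_eq_iff distrib_left)

definition outer :: "complex^'m \<Rightarrow> complex^'m^'m" where
  "outer v = (\<chi> i j. v $ i * cnj (v $ j))"

lemma bounded_linear_smul_left: "bounded_linear (\<lambda>a. smul a A)"
  unfolding linear_conv_bounded_linear[symmetric] linear_iff
  by (auto simp: vec_eq_iff algebra_simps)

text \<open>The Cayley transform \<open>1 + i t P / (1 - i q t / 2)\<close> of the rank-one matrix \<open>P = v v\<^sup>* J\<close>,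
  where \<open>P\<^sup>2 = q P\<close>, is a curve in the group for all \<open>t\<close>, also when \<open>q = 0\<close>.\<close>

lemma rank_one_in_lie_algebra:
  assumes J: "conj_transpose J = J"
  shows "smul \<i> (outer v ** J) \<in> lie_algebra (form_group J)"
proof -
  define P where "P = outer v ** J"
  define q where "q = (\<Sum>i\<in>UNIV. \<Sum>j\<in>UNIV. cnj (v $ i) * J $ i $ j * v $ j)"
  have Jn: "cnj (J $ i $ j) = J $ j $ i" for i j
    using J by (metis conj_transpose_nth)
  have "cnj q = (\<Sum>i\<in>UNIV. \<Sum>j\<in>UNIV. cnj (v $ j) * J $ j $ i * v $ i)"
    by (simp add: q_def Jn mult_ac)
  also have "\<dots> = q" unfolding q_def by (rule sum.swap)
  finally have qr: "cnj q = q" .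
  have oo: "outer v ** J ** outer v = smul q (outer v)"
  proof -
    have "(outer v ** J ** outer v) $ a $ b = q * outer v $ a $ b" for a b
    proof -
      have "(outer v ** J ** outer v) $ a $ b =
          (\<Sum>j\<in>UNIV. \<Sum>i\<in>UNIV. (cnj (v $ i) * J $ i $ j * v $ j) * (v $ a * cnj (v $ b)))"
        by (simp add: matrix_matrix_mult_def outer_def sum_distrib_left sum_distrib_right mult_ac)
      also have "\<dots> = (\<Sum>j\<in>UNIV. \<Sum>i\<in>UNIV. cnj (v $ i) * J $ i $ j * v $ j) * (v $ a * cnj (v $ b))"
        by (simp add: sum_distrib_right)
      also have "(\<Sum>j\<in>UNIV. \<Sum>i\<in>UNIV. cnj (v $ i) * J $ i $ j * v $ j) = q"
        unfolding q_def by (rule sum.swap)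
      finally show ?thesis by (simp add: outer_def)
    qed
    then show ?thesis by (simp add: vec_eq_iff)
  qed
  have co: "conj_transpose (outer v) = outer v" by (simp add: vec_eq_iff outer_def)
  have PJ: "conj_transpose P ** J = J ** P"
    by (simp add: P_def conj_transpose_mult co J matrix_mul_assoc)
  have PJP: "conj_transpose P ** J ** P = smul q (J ** P)"
  proof -
    have "conj_transpose P ** J ** P = J ** (outer v ** J ** outer v) ** J"
      unfolding PJ by (simp add: P_def matrix_mul_assoc)
    then show ?thesis by (simp add: oo smul_mult P_def matrix_mul_assoc)
  qed
  define d where "d t = 1 - \<i> * q * complex_of_real t / 2" for t
  have dnz: "d t \<noteq> 0" for t
  proof -
    have "Im q = 0" using qr by (metis complex_cnj_cancel_iff complex_In_mult_cnj_zero Reals_cnj_iff complex_is_Real_iff)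
    then have "Re (d t) = 1" by (simp add: d_def)
    then show ?thesis by auto
  qed
  have cd: "cnj (d t) = 1 + \<i> * q * complex_of_real t / 2" for t by (simp add: d_def qr)
  define a where "a t = \<i> * complex_of_real t / d t" for t
  \<comment> \<open>This is the coefficient of \<open>J ** P\<close> in the difference of
    \<open>conj_transpose (\<gamma> t) ** J ** \<gamma> t\<close> and \<open>J\<close>; the
    denominator \<open>d\<close> is chosen to make it vanish.\<close>
  have aeq: "cnj (a t) + a t + cnj (a t) * a t * q = 0" for t
  proof -
    have cdnz: "cnj (d t) \<noteq> 0" using dnz by simp
    have "cnj (a t) + a t + cnj (a t) * a t * q =
       (\<i> * t * (cnj (d t) - d t) + t * t * q) / (d t * cnj (d t))"
      using dnz[of t] cdnz by (simp add: a_def field_simps)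
    also have "\<i> * t * (cnj (d t) - d t) + t * t * q = 0"
      unfolding cd by (simp add: d_def algebra_simps)
    finally show ?thesis by simp
  qed
  have ader: "(a has_vector_derivative \<i> / (d t)\<^sup>2) (at t)" for t
  proof -
    have "((\<lambda>z. \<i> * z / (1 - \<i> * q * z / 2)) has_field_derivative \<i> / (d t)\<^sup>2) (at (complex_of_real t))"
      using dnz[of t] unfolding d_def
      by (auto intro!: derivative_eq_intros simp: power2_eq_square) (simp add: algebra_simps)
    then show ?thesis
      unfolding a_def[abs_def] d_def by (rule has_vector_derivative_real_field)
  qed
  define \<gamma> where "\<gamma> t = mat 1 + smul (a t) P" for t
  have "\<gamma> t \<in> form_group J" for t
  proof -
    have "conj_transpose (\<gamma> t) ** J ** \<gamma> t =
        J + smul (a t) (J ** P) + smul (cnj (a t)) (conj_transpose P ** J) + smul (cnj (a t)) (smul (a t) (conj_transpose P ** J ** P))"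
      by (simp add: \<gamma>_def conj_transpose_add conj_transpose_smul smul_mult smul_add smul_smul mult.commute matrix_add_ldistrib
        matrix_add_mult algebra_simps)
    also have "\<dots> = J + smul (cnj (a t) + a t + cnj (a t) * a t * q) (J ** P)"
      unfolding PJP unfolding PJ by (simp add: vec_eq_iff algebra_simps)
    also have "\<dots> = J" unfolding aeq by (simp add: vec_eq_iff)
    finally show ?thesis by (simp add: form_group_def)
  qed
  moreover have "(\<gamma> has_vector_derivative smul (\<i> / (d t)\<^sup>2) P) (at t)" for t
    unfolding \<gamma>_def[abs_def]
    using has_vector_derivative_add[OF has_vector_derivative_const
      bounded_linear.has_vector_derivative[OF bounded_linear_smul_left ader[of t]]] by simp
  moreover have "\<gamma> 0 = mat 1" by (simp add: \<gamma>_def a_def vec_eq_iff)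
  ultimately show ?thesis
    by (rule lie_algebraI) (simp add: P_def d_def)
qed

lemma matrix_mult_minus:
  fixes A B :: "complex^'m^'m"
  shows "A ** (- B) = - (A ** B)" "(- A) ** B = - (A ** B)"
  by (simp_all add: vec_eq_iff matrix_matrix_mult_def sum_negf)

lemma sum_sum_delta:
  "(\<Sum>i\<in>(UNIV::'a::finite set). \<Sum>j\<in>(UNIV::'b::finite set). if p = i \<and> q = j then f i j else 0) = f p q"
proof -
  have "(\<Sum>j\<in>(UNIV::'b set). if p = i \<and> q = j then f i j else 0) = (if p = i then f i q else 0)" for i
    by (cases "p = i") simp_all
  then show ?thesis by simp
qed

text \<open>One inclusion differentiates the invariance of \<open>J\<close>. For the other,
  \<open>X\<close> is \<i> \<open>H J\<close> with \<open>H\<close> Hermitian, and Hermitian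
  matrices are real combinations of rank-one matrices \<open>v v*\<close>, to which
  \<open>rank_one_in_lie_algebra\<close> applies.\<close>

lemma lie_algebra_form_group:
  fixes J :: "complex^'m^'m"
  assumes J: "conj_transpose J = J" and JJ: "J ** J = mat 1"
  shows "lie_algebra (form_group J) = {X. conj_transpose X ** J + J ** X = 0}"
proof (intro set_eqI iffI CollectI)
  fix X assume "X \<in> lie_algebra (form_group J)"
  then obtain \<gamma> \<gamma>' where g: "\<And>t. \<gamma> t \<in> form_group J" "\<And>t. (\<gamma> has_vector_derivative \<gamma>' t) (at t)"
    "\<gamma> 0 = mat 1" "\<gamma>' 0 = X" by (rule lie_algebraE) (rule that)
  have "((\<lambda>t. conj_transpose (\<gamma> t) ** J ** \<gamma> t) has_vector_derivative
      (conj_transpose (\<gamma> 0) ** J) ** \<gamma>' 0 + (conj_transpose (\<gamma> 0) ** 0 + conj_transpose (\<gamma>' 0) ** J) ** \<gamma> 0) (at 0)"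
    by (intro has_vector_derivative_matrix_mult has_vector_derivative_const
      bounded_linear.has_vector_derivative[OF bounded_linear_conj_transpose] g(2))
  moreover have "(\<lambda>t. conj_transpose (\<gamma> t) ** J ** \<gamma> t) = (\<lambda>t. J)"
    using g(1) by (simp add: form_group_def)
  ultimately have "((\<lambda>t. J) has_vector_derivative
      (conj_transpose (\<gamma> 0) ** J) ** \<gamma>' 0 + (conj_transpose (\<gamma> 0) ** 0 + conj_transpose (\<gamma>' 0) ** J) ** \<gamma> 0) (at 0)"
    by simp
  from vector_derivative_unique_at[OF this has_vector_derivative_const]
  have "(conj_transpose (\<gamma> 0) ** J) ** \<gamma>' 0 + (conj_transpose (\<gamma> 0) ** 0 + conj_transpose (\<gamma>' 0) ** J) ** \<gamma> 0 = 0" .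
  then show "conj_transpose X ** J + J ** X = 0" by (simp add: g add.commute)
next
  fix X assume "X \<in> {X. conj_transpose X ** J + J ** X = 0}"
  then have X: "conj_transpose X ** J = - (J ** X)" by (simp add: eq_neg_iff_add_eq_0)
  let ?L = "lie_algebra (form_group J)"
  have L: "subspace ?L"
    by (rule subspace_lie_algebra) (auto intro: form_group_mult mat_1_in_form_group)
  define T where "T A = smul \<i> (A ** J)" for A :: "complex^'m^'m"
  have linT: "linear T"
    unfolding T_def linear_iff
    by (auto simp: vec_eq_iff matrix_add_mult distrib_left bounded_bilinear.scaleR_left[OF bounded_bilinear_matrix_mult])
  define H where "H = smul (- \<i>) (X ** J)"
  have H: "cnj (H $ i $ j) = H $ j $ i" for i j
  proof -
    have "conj_transpose (X ** J) = J ** conj_transpose X ** (J ** J)"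
      by (simp add: conj_transpose_mult J JJ)
    also have "\<dots> = J ** (conj_transpose X ** J) ** J" by (simp add: matrix_mul_assoc)
    also have "\<dots> = - ((J ** J) ** X ** J)"
      unfolding X by (simp add: matrix_mult_minus matrix_mul_assoc)
    finally have "conj_transpose (X ** J) $ j $ i = - ((X ** J) $ j $ i)" by (simp add: JJ)
    then show ?thesis by (simp add: H_def)
  qed
  define E where "E z i = (\<chi> p. if p = i then z else (0::complex))" for z and i :: 'm
  \<comment> \<open>Polarization: this combination of rank-one matrices has \<open>z\<close> at
    position \<open>(i, j)\<close> and \<open>cnj z\<close> at \<open>(j, i)\<close>, the two values
    adding up if \<open>i = j\<close>.\<close>
  define G where "G z i j = outer (E z i + E 1 j) - (cmod z)\<^sup>2 *\<^sub>R outer (E 1 i) - outer (E 1 j)" for z i j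
  have Gn: "G z i j $ p $ q = (if p = i \<and> q = j then z else 0) + (if q = i \<and> p = j then cnj z else 0)" for z i j p q
  proof -
    have "(cmod z)\<^sup>2 *\<^sub>R w = z * cnj z * w" for w
      by (simp only: scaleR_conv_of_real complex_norm_square)
    then show ?thesis
      unfolding G_def outer_def E_def
      by (cases "p = i"; cases "q = j"; cases "p = j"; cases "q = i") (simp_all add: distrib_left distrib_right)
  qed
  have TG: "T (G z i j) \<in> ?L" for z i j
    unfolding G_def linear_diff[OF linT] linear_cmul[OF linT]
    by (intro subspace_diff[OF L] subspace_scale[OF L]) (auto simp: T_def intro: rank_one_in_lie_algebra[OF J])
  \<comment> \<open>The sum over all pairs meets each entry twice, once as \<open>H $ p $ q\<close>
    and once as \<open>cnj (H $ q $ p)\<close>; hence the factor 1/2.\<close>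
  have "H = (1/2) *\<^sub>R (\<Sum>i\<in>UNIV. \<Sum>j\<in>UNIV. G (H $ i $ j) i j)"
  proof -
    have "(\<Sum>i\<in>UNIV. \<Sum>j\<in>UNIV. G (H $ i $ j) i j) $ p $ q = H $ p $ q + cnj (H $ q $ p)" for p q
      by (simp only: sum_component Gn sum.distrib sum_sum_delta)
    then show ?thesis by (simp add: vec_eq_iff H)
  qed
  from arg_cong[OF this, of T]
  have "T H = (1/2) *\<^sub>R (\<Sum>i\<in>UNIV. \<Sum>j\<in>UNIV. T (G (H $ i $ j) i j))"
    by (simp only: linear_cmul[OF linT] linear_sum[OF linT])
  also have "\<dots> \<in> ?L"
    by (intro subspace_scale[OF L] subspace_sum[OF L] TG)
  also have "T H = X"
    by (simp add: T_def H_def smul_mult smul_smul JJ flip: matrix_mul_assoc) (simp add: vec_eq_iff)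
  finally show "X \<in> ?L" .
qed

section \<open>Derivative of the determinant along a curve\<close>

lemma det_has_vector_derivative:
  fixes \<gamma> :: "real \<Rightarrow> complex^'m^'m"
  assumes "(\<gamma> has_vector_derivative X) (at t)"
  shows "((\<lambda>s. det (\<gamma> s)) has_vector_derivative
    (\<Sum>p | p permutes UNIV. of_int (sign p) * (\<Sum>i\<in>UNIV. X $ i $ p i * (\<Prod>j\<in>UNIV-{i}. \<gamma> t $ j $ p j)))) (at t)"
proof -
  have "((\<lambda>s. \<Prod>i\<in>UNIV. \<gamma> s $ i $ p i) has_derivative
      (\<lambda>h. \<Sum>i\<in>UNIV. h *\<^sub>R X $ i $ p i * (\<Prod>j\<in>UNIV-{i}. \<gamma> t $ j $ p j))) (at t)" for p :: "'m \<Rightarrow> 'm"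
    by (rule has_derivative_prod) (use has_vector_derivative_nth[OF assms] in \<open>simp add: has_vector_derivative_def\<close>)
  then have "((\<lambda>s. \<Prod>i\<in>UNIV. \<gamma> s $ i $ p i) has_vector_derivative
      (\<Sum>i\<in>UNIV. X $ i $ p i * (\<Prod>j\<in>UNIV-{i}. \<gamma> t $ j $ p j))) (at t)" for p :: "'m \<Rightarrow> 'm"
    by (simp add: has_vector_derivative_def scaleR_sum_right)
  then show ?thesis
    unfolding det_def
    by (intro has_vector_derivative_sum has_vector_derivative_mult_right)
qed

text \<open>A permutation other than the identity moves at least two points, so after one factor has
  been differentiated away an off-diagonal zero of the identity matrix remains.\<close>

lemma det_derivative_at_mat_1:
  fixes X :: "complex^'m^'m"
  shows "(\<Sum>p | p permutes UNIV. of_int (sign p) * (\<Sum>i\<in>UNIV. X $ i $ p i * (\<Prod>j\<in>UNIV-{i}. mat 1 $ j $ p j))) = trace X"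
proof -
  have z: "(\<Prod>j\<in>UNIV-{i}. (mat 1 :: complex^'m^'m) $ j $ p j) = 0" if p: "p permutes UNIV" "p \<noteq> id" for p and i :: 'm
  proof -
    have "\<exists>j. j \<noteq> i \<and> p j \<noteq> j"
    proof (rule ccontr)
      assume "\<not> ?thesis"
      then have f: "p j = j" if "j \<noteq> i" for j using that by blast
      have "p i = i"
        using f[of "p i"] permutes_inj[OF p(1)] by (metis injD)
      with f have "p j = j" for j by (cases "j = i") auto
      then have "p = id" by (simp add: fun_eq_iff)
      with p show False by blast
    qed
    then obtain j where j: "j \<noteq> i" "p j \<noteq> j" by blast
    then have "j \<in> UNIV - {i} \<and> (mat 1 :: complex^'m^'m) $ j $ p j = 0" by (simp add: mat_def)
    then show ?thesis by (intro prod_zero) auto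
  qed
  have "(\<Sum>p | p permutes UNIV. of_int (sign p) * (\<Sum>i\<in>UNIV. X $ i $ p i * (\<Prod>j\<in>UNIV-{i}. mat 1 $ j $ p j))) =
      (\<Sum>p\<in>{id}. of_int (sign p) * (\<Sum>i\<in>UNIV. X $ i $ p i * (\<Prod>j\<in>UNIV-{i}. mat 1 $ j $ p j)))"
    by (intro sum.mono_neutral_right) (auto simp: z permutes_id finite_permutations)
  also have "\<dots> = trace X" by (simp add: trace_def mat_def sign_id)
  finally show ?thesis .
qed

lemma det_curve_derivative:
  fixes \<gamma> \<gamma>' :: "real \<Rightarrow> complex^'m^'m"
  assumes "\<And>t. (\<gamma> has_vector_derivative \<gamma>' t) (at t)" "\<gamma> 0 = mat 1"
  obtains \<delta>' where "\<And>t. ((\<lambda>s. det (\<gamma> s)) has_vector_derivative \<delta>' t) (at t)" "\<delta>' 0 = trace (\<gamma>' 0)"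
proof (rule that)
  show "((\<lambda>s. det (\<gamma> s)) has_vector_derivative (\<lambda>t. \<Sum>p | p permutes UNIV. of_int (sign p) *
      (\<Sum>i\<in>UNIV. \<gamma>' t $ i $ p i * (\<Prod>j\<in>UNIV-{i}. \<gamma> t $ j $ p j))) t) (at t)" for t
    by (rule det_has_vector_derivative[OF assms(1)])
  show "(\<lambda>t. \<Sum>p | p permutes UNIV. of_int (sign p) *
      (\<Sum>i\<in>UNIV. \<gamma>' t $ i $ p i * (\<Prod>j\<in>UNIV-{i}. \<gamma> t $ j $ p j))) 0 = trace (\<gamma>' 0)"
    by (simp only: assms(2) det_derivative_at_mat_1)
qed

lemma inverse_det_curve_derivative:
  fixes \<gamma> \<gamma>' :: "real \<Rightarrow> complex^'m^'m"
  assumes "\<And>t. (\<gamma> has_vector_derivative \<gamma>' t) (at t)" "\<gamma> 0 = mat 1" "\<And>t. det (\<gamma> t) \<noteq> 0"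
  obtains \<delta>' where "\<And>t. ((\<lambda>s. inverse (det (\<gamma> s))) has_vector_derivative \<delta>' t) (at t)" "\<delta>' 0 = - trace (\<gamma>' 0)"
proof -
  obtain \<delta>' where d: "\<And>t. ((\<lambda>s. det (\<gamma> s)) has_vector_derivative \<delta>' t) (at t)" "\<delta>' 0 = trace (\<gamma>' 0)"
    by (rule det_curve_derivative[OF assms(1,2)]) (rule that)
  have "((inverse \<circ> (\<lambda>s. det (\<gamma> s))) has_vector_derivative \<delta>' t * - (inverse (det (\<gamma> t)) ^ Suc (Suc 0))) (at t)" for t
    by (rule field_vector_diff_chain_at[OF d(1)]) (rule DERIV_inverse[OF assms(3)])
  then show thesis
    by (intro that[of "\<lambda>t. \<delta>' t * - (inverse (det (\<gamma> t)) ^ Suc (Suc 0))"])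
      (auto simp: o_def assms d(2) det_I)
qed

section \<open>The Lie algebras of SU(n,1), K and T as explicit matrix spaces\<close>

lemma trace_UNIV_option: "trace X = X $ None $ None + (\<Sum>k\<in>UNIV. X $ Some k $ Some k)"
  by (simp add: trace_def sum_UNIV_option)

lemma has_vector_derivative_block_diag:
  assumes "(A has_vector_derivative A') (at t)" "(d has_vector_derivative d') (at t)"
  shows "((\<lambda>t. block_diag (A t) (d t)) has_vector_derivative block_diag A' d') (at t)"
  using bounded_linear.has_vector_derivative[OF bounded_linear_block_diag has_vector_derivative_Pair[OF assms]] by simp

text \<open>A curve in U(n,1) is pushed into SU(n,1) by \<open>normalize_det\<close>. The correcting
  factor has initial velocity minus the trace in its corner, so a traceless \<open>X\<close> keeps
  its velocity.\<close>

lemma lie_g_eq: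
  "(lie_g :: ('n::finite) cmat set) = {X. conj_transpose X ** I_n1 + I_n1 ** X = 0 \<and> trace X = 0}"
proof (intro set_eqI iffI CollectI conjI)
  fix X :: "'n cmat" assume X: "X \<in> lie_g"
  have "X \<in> lie_algebra (form_group I_n1)"
    using X lie_algebra_mono[of SU_n1 "form_group I_n1"] unfolding lie_g_def SU_n1_eq by blast
  then show "conj_transpose X ** I_n1 + I_n1 ** X = 0"
    by (simp add: lie_algebra_form_group conj_transpose_I_n1 I_n1_mult_I_n1)
  from X obtain \<gamma> \<gamma>' where g: "\<And>t. \<gamma> t \<in> SU_n1" "\<And>t. (\<gamma> has_vector_derivative \<gamma>' t) (at t)"
    "\<gamma> 0 = mat 1" "\<gamma>' 0 = X" unfolding lie_g_def by (rule lie_algebraE) (rule that)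
  obtain \<delta>' where d: "\<And>t. ((\<lambda>s. det (\<gamma> s)) has_vector_derivative \<delta>' t) (at t)" "\<delta>' 0 = trace (\<gamma>' 0)"
    by (rule det_curve_derivative[OF g(2,3)]) (rule that)
  have "((\<lambda>s. 1) has_vector_derivative \<delta>' 0) (at 0)"
    using d(1)[of 0] g(1) by (simp add: SU_n1_eq)
  from vector_derivative_unique_at[OF this has_vector_derivative_const] show "trace X = 0"
    by (simp add: d g)
next
  fix X :: "'n cmat" assume "X \<in> {X. conj_transpose X ** I_n1 + I_n1 ** X = 0 \<and> trace X = 0}"
  then have "X \<in> lie_algebra (form_group I_n1)" and tr: "trace X = 0"
    by (simp_all add: lie_algebra_form_group conj_transpose_I_n1 I_n1_mult_I_n1)
  from this(1) obtain \<gamma> \<gamma>' where g: "\<And>t. \<gamma> t \<in> form_group I_n1" "\<And>t. (\<gamma> has_vector_derivative \<gamma>' t) (at t)"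
    "\<gamma> 0 = mat 1" "\<gamma>' 0 = X" by (rule lie_algebraE) (rule that)
  have "det (\<gamma> t) \<noteq> 0" for t using form_group_I_n1_det[OF g(1)[of t]] by auto
  then obtain \<delta>' where d: "\<And>t. ((\<lambda>s. inverse (det (\<gamma> s))) has_vector_derivative \<delta>' t) (at t)" "\<delta>' 0 = - trace (\<gamma>' 0)"
    using inverse_det_curve_derivative[OF g(2,3)] by metis
  have b1: "block_diag (mat 1) 1 = (mat 1 :: 'n cmat)" and b0: "block_diag 0 0 = (0 :: 'n cmat)"
    by (simp_all add: vec_eq_option_iff mat_def)
  show "X \<in> lie_g" unfolding lie_g_def
  proof (rule lie_algebraI)
    show "\<gamma> t ** block_diag (mat 1) (inverse (det (\<gamma> t))) \<in> SU_n1" for t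
      by (rule normalize_det[OF g(1)])
    show "((\<lambda>t. \<gamma> t ** block_diag (mat 1) (inverse (det (\<gamma> t)))) has_vector_derivative
      \<gamma> t ** block_diag 0 (\<delta>' t) + \<gamma>' t ** block_diag (mat 1) (inverse (det (\<gamma> t)))) (at t)" for t
      by (intro has_vector_derivative_matrix_mult g(2) has_vector_derivative_block_diag d(1) has_vector_derivative_const)
    show "\<gamma> 0 ** block_diag (mat 1) (inverse (det (\<gamma> 0))) = mat 1"
      by (simp add: g b1)
    show "\<gamma> 0 ** block_diag 0 (\<delta>' 0) + \<gamma>' 0 ** block_diag (mat 1) (inverse (det (\<gamma> 0))) = X"
      by (simp add: g d b1 b0 tr)
  qed
qed

lemma unitary_det_nonzero:
  assumes "A \<in> unitary_group" shows "det A \<noteq> 0"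
proof -
  have "det (conj_transpose A ** A) = 1" using assms by (simp add: unitary_group_def)
  then show ?thesis by (auto simp: det_mul)
qed

lemma K_grp_unitary: "(K_grp :: ('n::finite) cmat set) \<subseteq> form_group (mat 1)"
proof
  fix M :: "'n cmat" assume "M \<in> K_grp"
  then obtain A :: "complex^'n^'n" where A: "A \<in> unitary_group" "M = block_diag A (inverse (det A))"
    unfolding K_grp_def by blast
  have AA: "conj_transpose A ** A = mat 1" using A by (simp add: unitary_group_def)
  have "cnj (det A) * det A = 1"
    using arg_cong[OF AA, of det] by (simp add: det_mul det_conj_transpose)
  then have d: "cnj (inverse (det A)) * inverse (det A) = 1"
    by (simp flip: inverse_mult_distrib)
  have "(\<Sum>k\<in>UNIV. cnj (A $ k $ i) * A $ k $ j) = (if i = j then 1 else 0)" for i j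
    using AA by (simp add: vec_eq_iff matrix_matrix_mult_def mat_def)
  then have "conj_transpose M ** M = mat 1" using d
    by (simp add: A vec_eq_option_iff matrix_matrix_mult_def sum_UNIV_option mat_def)
  then show "M \<in> form_group (mat 1)" by (simp add: form_group_def)
qed

definition upper_left :: "('n::finite) cmat \<Rightarrow> complex^'n^'n" where
  "upper_left X = (\<chi> i j. X $ Some i $ Some j)"

lemma upper_left_nth [simp]: "upper_left X $ i $ j = X $ Some i $ Some j"
  by (simp add: upper_left_def)

lemma bounded_linear_upper_left: "bounded_linear upper_left"
  unfolding linear_conv_bounded_linear[symmetric] linear_iff by (auto simp: vec_eq_iff)

lemma upper_left_block_diag [simp]: "upper_left (block_diag A d) = A"
  by (simp add: vec_eq_iff)

lemma upper_left_mat_1 [simp]: "upper_left (mat 1) = mat 1"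
  by (simp add: vec_eq_iff mat_def)

lemma mat_1_None: "mat 1 $ None $ None = 1"
  by (simp add: mat_def)

text \<open>Each relation is the derivative of one that holds along curves in \<open>K_grp\<close>:
  unitarity, vanishing of the off-block entries, and corner entry times determinant of the block
  equal to 1.\<close>

lemma lie_k_subset:
  assumes X: "X \<in> lie_k"
  shows "conj_transpose X + X = 0" "trace X = 0" "X $ Some a $ None = 0" "X $ None $ Some a = 0"
proof -
  have "X \<in> lie_algebra (form_group (mat 1))"
    using X lie_algebra_mono[OF K_grp_unitary] unfolding lie_k_def by blast
  then show "conj_transpose X + X = 0" by (simp add: lie_algebra_form_group)
  from X obtain \<gamma> \<gamma>' where g: "\<And>t. \<gamma> t \<in> K_grp" "\<And>t. (\<gamma> has_vector_derivative \<gamma>' t) (at t)"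
    "\<gamma> 0 = mat 1" "\<gamma>' 0 = X" unfolding lie_k_def by (rule lie_algebraE) (rule that)
  have K: "\<gamma> t $ Some a $ None = 0" "\<gamma> t $ None $ Some a = 0"
    "\<gamma> t $ None $ None * det (upper_left (\<gamma> t)) = 1" for t a
    using g(1)[of t] unfolding K_grp_def by (auto simp: unitary_det_nonzero)
  have e: "((\<lambda>t. \<gamma> t $ i $ j) has_vector_derivative X $ i $ j) (at 0)" for i j
    using has_vector_derivative_nth[OF g(2)[of 0]] by (simp add: g)
  show "X $ Some a $ None = 0"
    using vector_derivative_unique_at[OF e[of "Some a" None, unfolded K] has_vector_derivative_const] .
  show "X $ None $ Some a = 0"
    using vector_derivative_unique_at[OF e[of None "Some a", unfolded K] has_vector_derivative_const] .
  have u: "((\<lambda>t. upper_left (\<gamma> t)) has_vector_derivative upper_left (\<gamma>' t)) (at t)" for t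
    by (rule bounded_linear.has_vector_derivative[OF bounded_linear_upper_left g(2)])
  have u0: "upper_left (\<gamma> 0) = mat 1" by (simp add: g)
  obtain \<delta>' where d: "\<And>t. ((\<lambda>s. det (upper_left (\<gamma> s))) has_vector_derivative \<delta>' t) (at t)"
      "\<delta>' 0 = trace (upper_left (\<gamma>' 0))"
    by (rule det_curve_derivative[OF u u0]) (rule that)
  have "((\<lambda>t. \<gamma> t $ None $ None * det (upper_left (\<gamma> t))) has_vector_derivative
      \<gamma> 0 $ None $ None * \<delta>' 0 + X $ None $ None * det (upper_left (\<gamma> 0))) (at 0)"
    by (rule has_vector_derivative_mult[OF e d(1)])
  then have "((\<lambda>t. 1) has_vector_derivative trace (upper_left X) + X $ None $ None) (at 0)"
    unfolding K by (simp add: g d mat_1_None)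
  from vector_derivative_unique_at[OF this has_vector_derivative_const]
  show "trace X = 0"
    by (simp add: trace_UNIV_option trace_def[of "upper_left X"] add.commute)
qed

lemma block_diag_mat_1_1: "block_diag (mat 1) 1 = mat 1"
  by (simp add: vec_eq_option_iff mat_def)

text \<open>Lifts a curve of unitary matrices to K. The corner has initial velocity minus the trace
  of the block, which is how the traceless matrices of \<open>lie_k\<close> and \<open>lie_t\<close>
  are reached.\<close>

lemma K_curve:
  assumes A: "\<And>t. A t \<in> unitary_group" "\<And>t. (A has_vector_derivative A' t) (at t)" "A 0 = mat 1"
  obtains \<delta>' where "\<And>t. ((\<lambda>t. block_diag (A t) (inverse (det (A t)))) has_vector_derivative block_diag (A' t) (\<delta>' t)) (at t)"
    "\<delta>' 0 = - trace (A' 0)" "block_diag (A 0) (inverse (det (A 0))) = mat 1"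
proof -
  obtain \<delta>' where d: "\<And>t. ((\<lambda>s. inverse (det (A s))) has_vector_derivative \<delta>' t) (at t)" "\<delta>' 0 = - trace (A' 0)"
    using inverse_det_curve_derivative[OF A(2,3)] unitary_det_nonzero[OF A(1)] by metis
  show thesis
    by (rule that[OF has_vector_derivative_block_diag[OF A(2) d(1)] d(2)]) (simp add: A block_diag_mat_1_1)
qed

lemma lie_k_eq:
  "(lie_k :: ('n::finite) cmat set) = {X. conj_transpose X + X = 0 \<and> trace X = 0 \<and>
     (\<forall>a. X $ Some a $ None = 0 \<and> X $ None $ Some a = 0)}"
proof (intro set_eqI iffI CollectI)
  fix X :: "'n cmat" assume "X \<in> lie_k"
  from lie_k_subset[OF this] show "conj_transpose X + X = 0 \<and> trace X = 0 \<and>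
     (\<forall>a. X $ Some a $ None = 0 \<and> X $ None $ Some a = 0)" by blast
next
  fix X :: "'n cmat" assume X: "X \<in> {X. conj_transpose X + X = 0 \<and> trace X = 0 \<and>
     (\<forall>a. X $ Some a $ None = 0 \<and> X $ None $ Some a = 0)}"
  then have "conj_transpose (upper_left X) + upper_left X = 0" by (simp add: vec_eq_iff)
  then have "upper_left X \<in> lie_algebra unitary_group"
    by (simp add: unitary_group_eq lie_algebra_form_group)
  then obtain A A' where A: "\<And>t. A t \<in> unitary_group" "\<And>t. (A has_vector_derivative A' t) (at t)" "A 0 = mat 1"
    "A' 0 = upper_left X" by (rule lie_algebraE) (rule that)
  obtain \<delta>' where d: "\<And>t. ((\<lambda>t. block_diag (A t) (inverse (det (A t)))) has_vector_derivative block_diag (A' t) (\<delta>' t)) (at t)"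
    "\<delta>' 0 = - trace (A' 0)" "block_diag (A 0) (inverse (det (A 0))) = mat 1"
    using K_curve[of A A'] A(1-3) by blast
  show "X \<in> lie_k" unfolding lie_k_def
  proof (rule lie_algebraI[OF _ d(1) d(3)])
    show "block_diag (A t) (inverse (det (A t))) \<in> K_grp" for t
      using A(1) by (auto simp: K_grp_def)
    have "trace (upper_left X) + X $ None $ None = 0"
      using X by (simp add: trace_UNIV_option trace_def[of "upper_left X"] add.commute)
    then have "- trace (upper_left X) = X $ None $ None" by (rule minus_unique)
    then show "block_diag (A' 0) (\<delta>' 0) = X"
      using X by (simp add: A d vec_eq_option_iff)
  qed
qed

text \<open>For the inclusion from right to left an explicit one-parameter group of diagonal phases
  is lifted, since the curves supplied by \<open>lie_algebra_form_group\<close> need not stay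
  diagonal.\<close>

lemma lie_t_eq:
  "(lie_t :: ('n::finite) cmat set) = {X. conj_transpose X + X = 0 \<and> trace X = 0 \<and>
     (\<forall>i j. i \<noteq> j \<longrightarrow> X $ i $ j = 0)}"
proof (intro set_eqI iffI CollectI)
  fix X :: "'n cmat" assume X: "X \<in> lie_t"
  then have "X \<in> lie_k"
    using lie_algebra_mono[of T_grp K_grp] unfolding lie_t_def lie_k_def T_grp_def by blast
  note k = lie_k_subset[OF this]
  from X obtain \<gamma> \<gamma>' where g: "\<And>t. \<gamma> t \<in> T_grp" "\<And>t. (\<gamma> has_vector_derivative \<gamma>' t) (at t)"
    "\<gamma> 0 = mat 1" "\<gamma>' 0 = X" unfolding lie_t_def by (rule lie_algebraE) (rule that)
  have "X $ i $ j = 0" if "i \<noteq> j" for i j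
  proof -
    have "\<gamma> t $ i $ j = 0" for t using g(1)[of t] that by (simp add: T_grp_def)
    then have "((\<lambda>t. 0) has_vector_derivative X $ i $ j) (at 0)"
      using has_vector_derivative_nth[OF g(2)[of 0], of i j] by (simp add: g)
    from vector_derivative_unique_at[OF this has_vector_derivative_const] show ?thesis .
  qed
  with k show "conj_transpose X + X = 0 \<and> trace X = 0 \<and> (\<forall>i j. i \<noteq> j \<longrightarrow> X $ i $ j = 0)" by blast
next
  fix X :: "'n cmat" assume X: "X \<in> {X. conj_transpose X + X = 0 \<and> trace X = 0 \<and> (\<forall>i j. i \<noteq> j \<longrightarrow> X $ i $ j = 0)}"
  define x where "x k = Im (X $ Some k $ Some k)" for k
  have "cnj (X $ p $ p) + X $ p $ p = 0" for p
    using X by (simp add: vec_eq_iff)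
  then have "Re (X $ p $ p) = 0" for p
    by (metis add.commute complex_add_cnj mult_eq_0_iff of_real_eq_0_iff zero_neq_numeral)
  then have Xk: "X $ Some k $ Some k = \<i> * x k" for k by (simp add: complex_eq_iff x_def)
  define A :: "real \<Rightarrow> complex^'n^'n" where "A t = (\<chi> i j. if i = j then cis (x i * t) else 0)" for t
  define A' :: "real \<Rightarrow> complex^'n^'n" where "A' t = (\<chi> i j. if i = j then \<i> * x i * cis (x i * t) else 0)" for t
  have "A t \<in> unitary_group" for t
    by (simp add: unitary_group_def vec_eq_iff matrix_matrix_mult_def A_def mat_def
        if_distrib[of "\<lambda>z. _ * z"] if_distrib[of "\<lambda>z. z * _"] if_distrib[of cnj] cis_cnj cis_mult cong: if_cong)
  moreover have "(A has_vector_derivative A' t) (at t)" for t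
  proof -
    have c: "((\<lambda>t. cis (x i * t)) has_vector_derivative \<i> * x i * cis (x i * t)) (at t)" for i
    proof -
      have "((\<lambda>z. exp (\<i> * x i * z)) has_field_derivative \<i> * x i * exp (\<i> * x i * t)) (at (complex_of_real t))"
        by (auto intro!: derivative_eq_intros)
      from has_vector_derivative_real_field[OF this] show ?thesis
        by (simp add: cis_conv_exp mult.assoc)
    qed
    \<comment> \<open>Writing the curve as a sum of scalar functions times diagonal matrix units
      reduces its derivative to that of \<open>cis\<close>.\<close>
    define B :: "'n \<Rightarrow> complex^'n^'n" where "B i = (\<chi> p q. if p = i \<and> q = i then 1 else 0)" for i
    have AB: "A s = (\<Sum>i\<in>UNIV. smul (cis (x i * s)) (B i))" for s
    proof -
      have "(\<Sum>i\<in>UNIV. smul (cis (x i * s)) (B i)) $ p $ q = (\<Sum>i\<in>UNIV. if p = i then (if p = q then cis (x p * s) else 0) else 0)" for p q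
        unfolding sum_component by (intro sum.cong refl) (auto simp: B_def)
      then show ?thesis by (simp add: vec_eq_iff A_def)
    qed
    have "A' t = (\<Sum>i\<in>UNIV. smul (\<i> * x i * cis (x i * t)) (B i))"
    proof -
      have "(\<Sum>i\<in>UNIV. smul (\<i> * x i * cis (x i * t)) (B i)) $ p $ q = (\<Sum>i\<in>UNIV. if p = i then (if p = q then \<i> * x p * cis (x p * t) else 0) else 0)" for p q
        unfolding sum_component by (intro sum.cong refl) (auto simp: B_def)
      then show ?thesis by (simp add: vec_eq_iff A'_def)
    qed
    then show ?thesis unfolding AB[abs_def]
      by (simp only:) (intro has_vector_derivative_sum bounded_linear.has_vector_derivative[OF bounded_linear_smul_left c])
  qed
  moreover have "A 0 = mat 1" by (simp add: A_def mat_def vec_eq_iff)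
  ultimately obtain \<delta>' where d: "\<And>t. ((\<lambda>t. block_diag (A t) (inverse (det (A t)))) has_vector_derivative block_diag (A' t) (\<delta>' t)) (at t)"
    "\<delta>' 0 = - trace (A' 0)" "block_diag (A 0) (inverse (det (A 0))) = mat 1"
    using K_curve[of A A'] by blast
  show "X \<in> lie_t" unfolding lie_t_def
  proof (rule lie_algebraI[OF _ d(1) d(3)])
    show "block_diag (A t) (inverse (det (A t))) \<in> T_grp" for t
      unfolding T_grp_def K_grp_def
    proof (intro CollectI conjI allI impI)
      show "block_diag (A t) (inverse (det (A t))) \<in> (\<lambda>A. block_diag A (inverse (det A))) ` unitary_group"
        using \<open>A t \<in> unitary_group\<close> by blast
      show "block_diag (A t) (inverse (det (A t))) $ i $ j = 0" if "i \<noteq> j" for i j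
        using that by (cases i; cases j) (auto simp: A_def)
    qed
    have "trace (A' 0) = (\<Sum>k\<in>UNIV. \<i> * x k)"
      unfolding trace_def by (simp add: A'_def)
    then have "trace (A' 0) + X $ None $ None = 0"
      using X by (simp add: trace_UNIV_option Xk add.commute)
    then have "- trace (A' 0) = X $ None $ None" by (rule minus_unique)
    then show "block_diag (A' 0) (\<delta>' 0) = X"
      using X by (simp add: A'_def d vec_eq_option_iff Xk)
  qed
qed

section \<open>The Killing form\<close>

text \<open>Removes the chosen basis: for a projection \<open>P\<close> onto \<open>V\<close>, the
  trace of \<open>f\<close> on \<open>V\<close> is the trace of \<open>f P\<close> on the ambient
  space. Expanding \<open>f (P e)\<close> in the basis \<open>B\<close> and summing over the
  orthonormal \<open>Basis\<close> reassembles each \<open>b\<close>.\<close>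

lemma trace_on_eq:
  fixes V :: "'v::euclidean_space set"
  assumes V: "subspace V" and f: "linear f" "\<And>x. x \<in> V \<Longrightarrow> f x \<in> V"
    and P: "linear P" "\<And>x. P x \<in> V" "\<And>x. x \<in> V \<Longrightarrow> P x = x"
  shows "trace_on V f = (\<Sum>e\<in>Basis. f (P e) \<bullet> e)"
proof -
  define B where "B = (SOME B. independent B \<and> span B = V)"
  obtain B0 where B0: "B0 \<subseteq> V" "independent B0" "V \<subseteq> span B0"
    using basis_exists by metis
  have "span B0 = V"
    using B0 span_minimal[OF B0(1) V] by blast
  with B0 have "independent B0 \<and> span B0 = V" by blast
  from someI[of "\<lambda>B. independent B \<and> span B = V", OF this]
  have B: "independent B" "span B = V" unfolding B_def by blast+
  have fin: "finite B" by (rule finiteI_independent[OF B(1)])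
  have in_span: "f (P x) \<in> span B" for x using f(2)[OF P(2)] B by simp
  have "(\<Sum>e\<in>Basis. f (P e) \<bullet> e) = (\<Sum>e\<in>Basis. (\<Sum>b\<in>B. representation B (f (P e)) b *\<^sub>R b) \<bullet> e)"
    using sum_representation_eq[OF B(1) in_span fin order_refl] by simp
  also have "\<dots> = (\<Sum>b\<in>B. \<Sum>e\<in>Basis. (b \<bullet> e) * representation B (f (P e)) b)"
    by (subst sum.swap) (simp add: inner_sum_left mult.commute)
  also have "\<dots> = (\<Sum>b\<in>B. representation B (f b) b)"
  proof (rule sum.cong[OF refl])
    fix b assume b: "b \<in> B"
    define h where "h x = representation B (f (P x)) b" for x
    have "linear h"
      unfolding linear_iff h_def
      using representation_add[OF B(1) in_span in_span] representation_scale[OF B(1) in_span]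
      by (simp add: linear_add[OF f(1)] linear_add[OF P(1)] linear_cmul[OF f(1)] linear_cmul[OF P(1)])
    have "(\<Sum>e\<in>Basis. (b \<bullet> e) * h e) = h (\<Sum>e\<in>Basis. (b \<bullet> e) *\<^sub>R e)"
      by (simp add: linear_sum[OF \<open>linear h\<close>] linear_cmul[OF \<open>linear h\<close>])
    also have "\<dots> = representation B (f b) b"
      using span_base[OF b] B(2) by (simp add: euclidean_representation h_def P(3))
    finally show "(\<Sum>e\<in>Basis. (b \<bullet> e) * representation B (f (P e)) b) = representation B (f b) b"
      by (simp add: h_def)
  qed
  also have "\<dots> = trace_on V f" by (simp add: trace_on_def B_def Let_def)
  finally show ?thesis ..
qed

lemma sum_Basis_vec:
  "(\<Sum>e\<in>(Basis :: ('a::euclidean_space ^ 'n) set). F e) = (\<Sum>i\<in>UNIV. \<Sum>u\<in>Basis. F (axis i u))"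
proof -
  have "(\<Sum>e\<in>(Basis :: ('a ^ 'n) set). F e) = (\<Sum>p\<in>UNIV \<times> Basis. F (axis (fst p) (snd p)))"
  proof (rule sum.reindex_cong[of "\<lambda>p. axis (fst p) (snd p)"])
    show "inj_on (\<lambda>p. axis (fst p) (snd p)) (UNIV \<times> (Basis :: 'a set))"
      by (auto simp: inj_on_def axis_eq_axis)
    show "(Basis :: ('a ^ 'n) set) = (\<lambda>p. axis (fst p) (snd p)) ` (UNIV \<times> Basis)"
      by (force simp: Basis_vec_def)
  qed simp
  also have "\<dots> = (\<Sum>i\<in>UNIV. \<Sum>u\<in>Basis. F (axis i u))"
    by (simp add: sum.cartesian_product case_prod_beta)
  finally show ?thesis .
qed

lemma sum_Basis_cmat:
  "(\<Sum>e\<in>(Basis :: (complex^'m^'m) set). F e) =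
     (\<Sum>i\<in>UNIV. \<Sum>j\<in>UNIV. F (axis i (axis j 1)) + F (axis i (axis j \<i>)))"
  by (simp add: sum_Basis_vec Basis_complex_def)

lemma mult_axis_mult_nth:
  fixes A B :: "complex^'m^'m"
  shows "(A ** axis i (axis j 1) ** B) $ p $ q = A $ p $ i * B $ j $ q"
proof -
  have "(A ** axis i (axis j 1)) $ p $ k = (if k = j then A $ p $ i else 0)" for k
    by (simp add: matrix_matrix_mult_def axis_def if_distrib[of "\<lambda>z. _ * z"] if_distrib[of "\<lambda>z. z $ _"] cong: if_cong)
  then show ?thesis
    by (simp add: matrix_matrix_mult_def[of _ B] if_distrib[of "\<lambda>z. z * _"] cong: if_cong)
qed

lemma axis_imaginary: "axis i (axis j \<i>) = smul \<i> (axis i (axis j 1))"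
  by (simp add: vec_eq_iff axis_def)

text \<open>The complex trace of \<open>ad X ad Y\<close> on all matrices, that is, the Killing form
  of gl(m). The four terms \<open>XYE\<close>, \<open>XEY\<close>, \<open>YEX\<close>,
  \<open>EYX\<close> are each of the form \<open>A E B\<close>, whose trace in \<open>E\<close> is a
  product of two traces.\<close>

lemma sum_ad_ad:
  fixes X Y :: "complex^'m^'m"
  shows "(\<Sum>i\<in>UNIV. \<Sum>j\<in>UNIV. ad X (ad Y (axis i (axis j 1))) $ i $ j) =
    2 * of_nat CARD('m) * trace (X ** Y) - 2 * trace X * trace Y"
proof -
  have "ad X (ad Y E) = (X ** Y) ** E ** mat 1 - X ** E ** Y - Y ** E ** X + mat 1 ** E ** (Y ** X)" for E
    by (simp add: ad_def matrix_mul_assoc bounded_bilinear.diff_left[OF bounded_bilinear_matrix_mult]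
      bounded_bilinear.diff_right[OF bounded_bilinear_matrix_mult])
  then have "ad X (ad Y (axis i (axis j 1))) $ i $ j =
      (X ** Y) $ i $ i - X $ i $ i * Y $ j $ j - Y $ i $ i * X $ j $ j + (Y ** X) $ j $ j" for i j
    by (simp only: vector_add_component vector_minus_component mult_axis_mult_nth) (simp add: mat_def)
  moreover have t: "(\<Sum>i\<in>UNIV. \<Sum>j\<in>UNIV. A $ i $ i * B $ j $ j) = trace A * trace B" for A B :: "complex^'m^'m"
    by (simp only: trace_def sum_product)
  ultimately have "(\<Sum>i\<in>UNIV. \<Sum>j\<in>UNIV. ad X (ad Y (axis i (axis j 1))) $ i $ j) =
     of_nat CARD('m) * trace (X ** Y) - trace X * trace Y - trace Y * trace X + of_nat CARD('m) * trace (Y ** X)"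
    by (simp add: sum.distrib sum_subtractf trace_def[of "X ** Y"] trace_def[of "Y ** X"] sum_distrib_left t)
  then show ?thesis by (simp add: trace_mul_sym[of Y X] mult.commute)
qed

lemma linear_ad: "linear (ad X)"
  unfolding linear_iff ad_def
  by (simp add: matrix_add_ldistrib matrix_add_mult bounded_bilinear.scaleR_left[OF bounded_bilinear_matrix_mult]
    bounded_bilinear.scaleR_right[OF bounded_bilinear_matrix_mult] scaleR_diff_right)

lemma ad_smul: "ad X (smul a Y) = smul a (ad X Y)"
  by (simp add: ad_def smul_mult vec_eq_iff algebra_simps)

lemma subspace_lie_g: "subspace lie_g"
  unfolding lie_g_def SU_n1_eq
  by (rule subspace_lie_algebra) (auto intro: form_group_mult mat_1_in_form_group simp: det_I det_mul)

lemma lie_g_swap: "X \<in> lie_g \<Longrightarrow> conj_transpose X ** I_n1 = - (I_n1 ** X)"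
  by (simp add: lie_g_eq eq_neg_iff_add_eq_0)

lemma ad_in_lie_g:
  assumes "X \<in> lie_g" "Y \<in> lie_g"
  shows "ad X Y \<in> lie_g"
proof -
  note s = lie_g_swap[OF assms(1)] lie_g_swap[OF assms(2)]
  have 1: "conj_transpose (A ** B) ** I_n1 = I_n1 ** (B ** A)"
    if "conj_transpose A ** I_n1 = - (I_n1 ** A)" "conj_transpose B ** I_n1 = - (I_n1 ** B)" for A B :: "'a cmat"
  proof -
    have "conj_transpose (A ** B) ** I_n1 = conj_transpose B ** (conj_transpose A ** I_n1)"
      by (simp add: conj_transpose_mult matrix_mul_assoc)
    also have "\<dots> = - ((conj_transpose B ** I_n1) ** A)"
      unfolding that(1) by (simp add: matrix_mult_minus matrix_mul_assoc)
    also have "\<dots> = I_n1 ** (B ** A)"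
      unfolding that(2) by (simp add: matrix_mult_minus matrix_mul_assoc)
    finally show ?thesis .
  qed
  have "conj_transpose (ad X Y) = conj_transpose (X ** Y) - conj_transpose (Y ** X)"
    by (simp add: ad_def vec_eq_iff)
  then have "conj_transpose (ad X Y) ** I_n1 + I_n1 ** ad X Y = 0"
    by (simp add: ad_def 1 s bounded_bilinear.diff_left[OF bounded_bilinear_matrix_mult]
      bounded_bilinear.diff_right[OF bounded_bilinear_matrix_mult])
  moreover have "trace (ad X Y) = 0" by (simp add: ad_def trace_sub trace_mul_sym[of X Y])
  ultimately show ?thesis by (simp add: lie_g_eq)
qed

text \<open>The anti-linear involution \<open>\<theta>\<close> whose fixed points form \<open>\<uu>(n,1)\<close>. Since the complex linear
  map \<open>ad X ad Y\<close> composed with \<open>\<theta>\<close> has real trace zero, projecting with \<open>(1 + \<theta>)/2\<close>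
  halves the real trace over all complex matrices.\<close>

definition theta :: "('n::finite) cmat \<Rightarrow> 'n cmat" where
  "theta Z = - (I_n1 ** conj_transpose Z ** I_n1)"

lemma theta_nth: "theta Z $ p $ q = - (I_n1 ** conj_transpose Z ** I_n1) $ p $ q"
  by (simp add: theta_def)

text \<open>The average with \<open>theta\<close> lands in u(n,1), and the scalar matrix subtracted
  makes it traceless. Scalars are annihilated by \<open>ad\<close>, so this correction disappears
  from the Killing form.\<close>

definition su_proj :: "('n::finite) cmat \<Rightarrow> 'n cmat" where
  "su_proj Z = (1/2) *\<^sub>R (Z + theta Z) - mat (trace ((1/2) *\<^sub>R (Z + theta Z)) / of_nat CARD('n option))"

lemma linear_theta: "linear theta"
  unfolding linear_iff by (auto simp: vec_eq_iff theta_nth)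

lemma trace_scaleR: "trace (c *\<^sub>R A) = c *\<^sub>R trace (A :: complex^'m^'m)"
  by (simp add: trace_def scaleR_sum_right)

lemma linear_su_proj: "linear (su_proj :: ('n::finite) cmat \<Rightarrow> _)"
proof -
  have "linear (\<lambda>Z :: 'n cmat. (1/2) *\<^sub>R (Z + theta Z))"
    unfolding linear_iff linear_add[OF linear_theta] linear_cmul[OF linear_theta]
    by (simp add: scaleR_add_right)
  moreover have "linear (\<lambda>A :: 'n cmat. A - mat (trace A / of_nat CARD('n option)))"
    unfolding linear_iff trace_add trace_scaleR
    by (auto simp: vec_eq_iff mat_def scaleR_conv_of_real[where 'a=complex] algebra_simps add_divide_distrib)
  ultimately show ?thesis
    using linear_compose unfolding su_proj_def[abs_def] o_def by blast
qed

lemma trace_mat: "trace (mat c :: complex^'m^'m) = of_nat CARD('m) * c"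
  by (simp add: trace_def mat_def)

lemma su_proj_in_lie_g: "su_proj Z \<in> lie_g"
proof -
  define Q where "Q = (1/2) *\<^sub>R (Z + theta Z)"
  define c where "c = trace Q / of_nat CARD('a option)"
  have Qs: "cnj (Q $ q $ p) * (if q = None then - 1 else 1) + (if p = None then - 1 else 1) * Q $ p $ q = 0" for p q
    by (simp add: Q_def theta_nth scaleR_conv_of_real[where 'a=complex] algebra_simps)
  have "cnj (Q $ p $ p) + Q $ p $ p = 0" for p
    using Qs[of p p] by (cases "p = None") (simp_all, metis add.inverse_inverse add_eq_0_iff)
  then have "cnj (trace Q) + trace Q = 0"
    unfolding trace_def cnj_sum sum.distrib[symmetric] by simp
  \<comment> \<open>Traces on u(n,1) are imaginary, hence the scalar matrix of \<open>c\<close> lies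
    in u(n,1) as well.\<close>
  then have c: "cnj c + c = 0"
    by (simp add: c_def flip: add_divide_distrib)
  have "conj_transpose (su_proj Z) ** I_n1 + I_n1 ** su_proj Z = 0"
    unfolding vec_eq_iff
  proof (intro allI)
    fix p q
    show "(conj_transpose (su_proj Z) ** I_n1 + I_n1 ** su_proj Z) $ p $ q = 0 $ p $ q"
      using Qs[of q p] c unfolding su_proj_def Q_def[symmetric] c_def[symmetric]
      by (auto simp: mat_def eq_neg_iff_add_eq_0 algebra_simps split: if_splits)
  qed
  moreover have n: "complex_of_nat CARD('a option) \<noteq> 0"
    unfolding of_nat_eq_0_iff by (rule zero_less_card_finite[THEN gr_implies_not0])
  have "trace (su_proj Z) = 0"
    unfolding su_proj_def Q_def[symmetric] c_def[symmetric] trace_sub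
    by (simp only: trace_mat c_def times_divide_eq_right nonzero_mult_div_cancel_left[OF n] diff_self)
  ultimately show ?thesis by (simp add: lie_g_eq)
qed

lemma theta_fixed:
  assumes "Z \<in> lie_g" shows "theta Z = Z"
proof -
  have "theta Z = I_n1 ** I_n1 ** Z"
    unfolding theta_def matrix_mul_assoc[symmetric] lie_g_swap[OF assms] by (simp add: matrix_mult_minus)
  then show ?thesis by (simp add: I_n1_mult_I_n1)
qed

lemma su_proj_fixed:
  assumes "Z \<in> lie_g" shows "su_proj Z = Z"
proof -
  have "(1/2) *\<^sub>R (Z + Z) = Z" by (simp add: vec_eq_iff)
  moreover have "trace Z = 0" using assms by (simp add: lie_g_eq)
  moreover have "mat 0 = (0 :: 'a cmat)" by (simp add: vec_eq_iff mat_def)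
  ultimately show ?thesis by (simp add: su_proj_def theta_fixed[OF assms])
qed

lemma theta_smul: "theta (smul a Z) = smul (cnj a) (theta Z)"
  by (simp add: vec_eq_iff theta_nth)

lemma ad_mat: "ad X (mat c) = 0"
  by (simp add: ad_def vec_eq_iff matrix_matrix_mult_def mat_def if_distrib[of "\<lambda>z. _ * z"] if_distrib[of "\<lambda>z. z * _"] cong: if_cong)

theorem killing_eq:
  assumes X: "X \<in> lie_g" and Y: "Y \<in> lie_g"
  shows "killing X (Y :: ('n::finite) cmat) = 2 * (real CARD('n) + 1) * Re (trace (X ** Y))"
proof -
  let ?f = "ad X \<circ> ad Y"
  have lin: "linear ?f" by (rule linear_compose[OF linear_ad linear_ad])
  have fE: "?f (su_proj Z) = (1/2) *\<^sub>R (?f Z + ?f (theta Z))" for Z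
    by (simp add: su_proj_def linear_diff[OF linear_ad] linear_cmul[OF linear_ad] linear_add[OF linear_ad] ad_mat linear_0[OF linear_ad])
  have "killing X Y = (\<Sum>e\<in>Basis. ?f (su_proj e) \<bullet> e)"
    unfolding killing_def
    by (rule trace_on_eq[OF subspace_lie_g lin _ linear_su_proj su_proj_in_lie_g su_proj_fixed])
      (auto intro: ad_in_lie_g X Y)
  also have "\<dots> = (1/2) * (\<Sum>e\<in>Basis. ?f e \<bullet> e + ?f (theta e) \<bullet> e)"
    unfolding fE by (simp add: inner_add_left sum_distrib_left)
  also have "(\<Sum>e\<in>Basis. ?f e \<bullet> e + ?f (theta e) \<bullet> e) =
      (\<Sum>i\<in>UNIV. \<Sum>j\<in>UNIV. 2 * Re (?f (axis i (axis j 1)) $ i $ j))"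
    unfolding sum_Basis_cmat
  proof (intro sum.cong refl)
    fix i j :: "'n option"
    let ?E = "axis i (axis j 1) :: 'n cmat"
    \<comment> \<open>The basis vectors \<open>E\<close> and \<i> \<open>E\<close> are taken
      together. Complex linearity makes their direct terms equal, whereas the terms with
      \<open>theta\<close> cancel because \<open>theta\<close> sends \<i> \<open>E\<close> to minus
      \<i> times \<open>theta E\<close>.\<close>
    have "?f (axis i (axis j \<i>)) = smul \<i> (?f ?E)"
      "?f (theta (axis i (axis j \<i>))) = smul (- \<i>) (?f (theta ?E))"
      by (simp_all add: axis_imaginary ad_smul theta_smul)
    moreover have "A \<bullet> axis i (axis j u) = A $ i $ j \<bullet> u" for A :: "'n cmat" and u
      by (simp add: inner_axis)
    ultimately show "?f ?E \<bullet> ?E + ?f (theta ?E) \<bullet> ?E +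
       (?f (axis i (axis j \<i>)) \<bullet> axis i (axis j \<i>) + ?f (theta (axis i (axis j \<i>))) \<bullet> axis i (axis j \<i>)) =
       2 * Re (?f ?E $ i $ j)"
      by (simp del: o_apply)
  qed
  also have "\<dots> = 2 * Re (\<Sum>i\<in>UNIV. \<Sum>j\<in>UNIV. ad X (ad Y (axis i (axis j 1))) $ i $ j)"
    by (simp add: sum_distrib_left)
  also have "\<dots> = 2 * Re (2 * of_nat CARD('n option) * trace (X ** Y))"
    using X unfolding sum_ad_ad by (simp add: lie_g_eq)
  finally show ?thesis by simp
qed

section \<open>The projection of the coadjoint orbit\<close>

definition diag_t :: "('n \<Rightarrow> real) \<Rightarrow> ('n::finite) cmat" where
  "diag_t x = block_diag (\<chi> i j. if i = j then \<i> * x i else 0) (- \<i> * (\<Sum>k\<in>UNIV. x k))"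

lemma diag_t_nth [simp]:
  "diag_t x $ Some i $ Some j = (if i = j then \<i> * x i else 0)"
  "diag_t x $ None $ None = - \<i> * (\<Sum>k\<in>UNIV. x k)"
  "diag_t x $ Some i $ None = 0"
  "diag_t x $ None $ Some i = 0"
  by (simp_all add: diag_t_def)

lemma diag_t_in_lie_t: "diag_t x \<in> lie_t"
proof -
  have "diag_t x $ p $ q = 0" if "p \<noteq> q" for p q
    using that by (cases p; cases q) auto
  then show ?thesis
    by (auto simp: lie_t_eq vec_eq_option_iff trace_UNIV_option sum_distrib_left sum_negf)
qed

lemma lie_t_eq_range: "(lie_t :: ('n::finite) cmat set) = range diag_t"
proof (intro subset_antisym subsetI)
  fix X :: "'n cmat" assume X: "X \<in> lie_t"
  then have "cnj (X $ p $ p) + X $ p $ p = 0" for p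
    by (simp add: lie_t_eq vec_eq_iff)
  then have "Re (X $ p $ p) = 0" for p
    by (metis add.commute complex_add_cnj mult_eq_0_iff of_real_eq_0_iff zero_neq_numeral)
  then have Xk: "X $ p $ p = \<i> * Im (X $ p $ p)" for p by (simp add: complex_eq_iff)
  have "X $ None $ None + (\<Sum>k\<in>UNIV. X $ Some k $ Some k) = 0"
    using X by (simp add: lie_t_eq trace_UNIV_option)
  then have "X $ None $ None = - (\<Sum>k\<in>UNIV. X $ Some k $ Some k)"
    by (simp add: eq_neg_iff_add_eq_0)
  also have "\<dots> = - \<i> * (\<Sum>k\<in>UNIV. Im (X $ Some k $ Some k))"
    by (subst Xk) (simp add: sum_distrib_left sum_negf)
  finally have "X = diag_t (\<lambda>k. Im (X $ Some k $ Some k))"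
    using X Xk by (auto simp: vec_eq_option_iff lie_t_eq)
  then show "X \<in> range diag_t" by blast
qed (auto simp: diag_t_in_lie_t)

lemma subspace_lie_t: "subspace lie_t"
  unfolding lie_t_eq subspace_def
  by (auto simp: trace_add trace_scaleR conj_transpose_add vec_eq_iff trace_def[of 0]) 
    (simp_all add: algebra_simps complex_eq_iff, metis distrib_left mult_zero_right)

lemma lie_k_subset_lie_g: "(lie_k :: ('n::finite) cmat set) \<subseteq> lie_g"
proof
  fix X :: "'n cmat" assume X: "X \<in> lie_k"
  have "cnj (X $ q $ p) + X $ p $ q = 0" for p q
    using X by (simp add: lie_k_eq vec_eq_iff)
  moreover from this[of None None] have "- cnj (X $ None $ None) - X $ None $ None = 0"
    by (metis add_uminus_conv_diff minus_add_distrib neg_equal_0_iff_equal)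
  ultimately show "X \<in> lie_g"
    using X by (simp add: lie_k_eq lie_g_eq vec_eq_option_iff)
qed

lemma lie_t_subset_lie_k: "lie_t \<subseteq> lie_k"
  by (auto simp: lie_t_eq lie_k_eq)

lemma e_vec_eq: "e_vec k = diag_t (\<lambda>j. if j = k then 1 else 0)"
  by (auto simp: vec_eq_option_iff e_vec_def)

lemma diag_t_eq_sum: "diag_t x = (\<Sum>k\<in>UNIV. x k *\<^sub>R e_vec k)"
proof -
  have "(\<Sum>k\<in>UNIV. (x k *\<^sub>R e_vec k) $ Some i $ Some j) = (if i = j then \<i> * x i else 0)" for i j
  proof -
    have "(x k *\<^sub>R e_vec k) $ Some i $ Some j = (if i = k then (if i = j then \<i> * x i else 0) else 0)" for k
      by (simp add: e_vec_eq scaleR_conv_of_real[where 'a=complex])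
    then show ?thesis by simp
  qed
  moreover have "(\<Sum>k\<in>UNIV. (x k *\<^sub>R e_vec k) $ None $ None) = - \<i> * (\<Sum>k\<in>UNIV. x k)"
    by (simp add: e_vec_eq scaleR_conv_of_real[where 'a=complex] sum_distrib_left mult.commute sum_negf)
  ultimately show ?thesis
    unfolding vec_eq_option_iff sum_component by (simp add: e_vec_eq)
qed

lemma dual_diag_t:
  assumes f: "f \<in> dual lie_t"
  shows "f (diag_t x) = (\<Sum>k\<in>UNIV. x k * f (e_vec k))"
proof -
  have add: "f (X + Y) = f X + f Y" and scale: "f (c *\<^sub>R X) = c * f X"
    if "X \<in> lie_t" "Y \<in> lie_t" for X Y c
    using f that by (auto simp: dual_def)
  have e: "x k *\<^sub>R e_vec k \<in> lie_t" for k
    by (intro subspace_scale[OF subspace_lie_t]) (simp add: e_vec_eq diag_t_in_lie_t)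
  have "f (\<Sum>k\<in>S. x k *\<^sub>R e_vec k) = (\<Sum>k\<in>S. x k * f (e_vec k))" if "finite S" for S
    using that
  proof induction
    case empty
    show ?case using scale[of 0 0 0] subspace_0[OF subspace_lie_t] by simp
  next
    case (insert k S)
    have m: "(\<Sum>k\<in>S. x k *\<^sub>R e_vec k) \<in> lie_t" by (rule subspace_sum[OF subspace_lie_t e])
    have v: "e_vec k \<in> lie_t" by (simp add: e_vec_eq diag_t_in_lie_t)
    show ?case using insert by (simp add: add[OF e m] scale[OF v v])
  qed
  then show ?thesis by (simp add: diag_t_eq_sum)
qed

lemma dual_chi_vec:
  assumes f: "f \<in> dual lie_t"
  shows "f (chi_vec k) = (real CARD('n) + 1) * f (e_vec k) - (\<Sum>i\<in>UNIV. f (e_vec (i :: 'n::finite)))"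
proof -
  have "chi_vec k = diag_t (\<lambda>j. (if j = k then real CARD('n) + 1 else 0) - 1)"
  proof -
    have "chi_vec k = (real CARD('n) + 1) *\<^sub>R e_vec k - diag_t (\<lambda>_. 1)"
      by (simp add: chi_vec_def diag_t_eq_sum)
    also have "\<dots> = diag_t (\<lambda>j. (if j = k then real CARD('n) + 1 else 0) - 1)"
      by (auto simp: e_vec_eq vec_eq_option_iff sum_subtractf scaleR_conv_of_real[where 'a=complex] algebra_simps)
    finally show ?thesis .
  qed
  then show ?thesis
    by (simp add: dual_diag_t[OF f] left_diff_distrib sum_subtractf if_distrib[of "\<lambda>z. z * _"] cong: if_cong)
qed

section \<open>The Killing form on t and the vectors representing functionals\<close>

lemma trace_diag_t_mult:
  "trace (diag_t x ** Y) = \<i> * ((\<Sum>k\<in>UNIV. x k * Y $ Some k $ Some k) - (\<Sum>k\<in>UNIV. x k) * Y $ None $ None)"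
proof -
  have "(diag_t x ** Y) $ Some k $ Some k = \<i> * (x k * Y $ Some k $ Some k)" for k
    by (simp add: matrix_matrix_mult_def sum_UNIV_option if_distrib[of "\<lambda>z. z * _"] cong: if_cong)
  moreover have "(diag_t x ** Y) $ None $ None = - \<i> * (\<Sum>k\<in>UNIV. x k) * Y $ None $ None"
    by (simp add: matrix_matrix_mult_def sum_UNIV_option)
  ultimately show ?thesis
    by (simp add: trace_UNIV_option algebra_simps flip: sum_distrib_left)
qed

lemma killing_diag_t:
  "killing (diag_t x) (diag_t y :: ('n::finite) cmat) =
    - (2 * (real CARD('n) + 1) * (\<Sum>k\<in>UNIV. (x k + (\<Sum>j\<in>UNIV. x j)) * y k))"
proof -
  have g: "diag_t z \<in> lie_g" for z :: "'n \<Rightarrow> real"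
    using diag_t_in_lie_t lie_t_subset_lie_k lie_k_subset_lie_g by blast
  have "trace (diag_t x ** (diag_t y :: 'n cmat)) =
      - of_real (\<Sum>k\<in>UNIV. (x k + (\<Sum>j\<in>UNIV. x j)) * y k)"
    unfolding trace_diag_t_mult
    by (simp add: distrib_right sum.distrib algebra_simps flip: sum_distrib_left sum_distrib_right)
  then show ?thesis by (simp add: killing_eq[OF g g])
qed

text \<open>The coordinates of the vector representing \<open>f\<close>: by
  \<open>killing_diag_t\<close> they solve \<open>-2 (n+1) (x k + S) = f (e_vec k)\<close> with
  \<open>S\<close> the sum of the \<open>x j\<close>. Summing over \<open>k\<close> determines
  \<open>S\<close> with a second factor \<open>n + 1\<close>, which turns \<open>e_vec\<close> into
  \<open>chi_vec\<close> and squares the denominator.\<close>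

definition kvec :: "(('n::finite) cmat \<Rightarrow> real) \<Rightarrow> 'n \<Rightarrow> real" where
  "kvec f k = - f (chi_vec k) / (2 * (real CARD('n) + 1)\<^sup>2)"

lemma sum_chi_vec:
  assumes f: "f \<in> dual lie_t"
  shows "(\<Sum>k\<in>UNIV. f (chi_vec (k::'n::finite))) = (\<Sum>k\<in>UNIV. f (e_vec k))"
  by (simp only: dual_chi_vec[OF f] sum_subtractf flip: sum_distrib_left) (simp add: distrib_right)

lemma kvec_shift:
  assumes f: "f \<in> dual lie_t"
  shows "kvec f k + (\<Sum>j\<in>UNIV. kvec f j) = - f (e_vec (k::'n::finite)) / (2 * (real CARD('n) + 1))"
proof -
  define N where "N = real CARD('n) + 1"
  have N: "N \<noteq> 0" by (simp add: N_def add_nonneg_eq_0_iff)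
  have "kvec f k + (\<Sum>j\<in>UNIV. kvec f j) = - (f (chi_vec k) + (\<Sum>j\<in>UNIV. f (chi_vec (j::'n)))) / (2 * N\<^sup>2)"
    by (simp add: kvec_def N_def add_divide_distrib diff_divide_distrib sum_negf flip: sum_divide_distrib)
  also have "\<dots> = - (N * f (e_vec k)) / (2 * N\<^sup>2)"
    unfolding sum_chi_vec[OF f] unfolding dual_chi_vec[OF f] by (simp add: N_def)
  also have "\<dots> = - f (e_vec k) / (2 * N)" using N by (simp add: power2_eq_square)
  finally show ?thesis by (simp add: N_def)
qed

lemma killing_kvec:
  assumes f: "f \<in> dual lie_t" and Y: "Y \<in> lie_t"
  shows "killing (diag_t (kvec f)) (Y :: ('n::finite) cmat) = f Y"
proof -
  obtain y where y: "Y = diag_t y" using Y by (auto simp: lie_t_eq_range)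
  define N where "N = real CARD('n) + 1"
  have N: "N \<noteq> 0" by (simp add: N_def add_nonneg_eq_0_iff)
  have "killing (diag_t (kvec f)) Y = - (2 * N * (\<Sum>k\<in>UNIV. - f (e_vec k) / (2 * N) * y k))"
    unfolding y killing_diag_t kvec_shift[OF f] N_def ..
  also have "\<dots> = (\<Sum>k\<in>UNIV. y k * f (e_vec k))"
    unfolding sum_distrib_left sum_negf[symmetric] by (intro sum.cong) (use N in simp_all)
  finally show ?thesis by (simp add: y dual_diag_t[OF f])
qed

text \<open>For uniqueness, the coordinates \<open>z\<close> of a difference of two solutions
  satisfy \<open>z l + S = 0\<close> for all \<open>l\<close>, where \<open>S\<close> is their sum.
  Adding these equations gives \<open>(n + 1) S = 0\<close>, hence \<open>z = 0\<close>.\<close>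

lemma killing_vec_lie_t:
  assumes f: "f \<in> dual lie_t"
  shows "killing_vec lie_t f = diag_t (kvec (f :: ('n::finite) cmat \<Rightarrow> real))"
  unfolding killing_vec_def
proof (rule the_equality)
  show "diag_t (kvec f) \<in> lie_t \<and> (\<forall>Y\<in>lie_t. killing (diag_t (kvec f)) Y = f Y)"
    using killing_kvec[OF f] diag_t_in_lie_t by blast
next
  fix X assume X: "X \<in> lie_t \<and> (\<forall>Y\<in>lie_t. killing X Y = f Y)"
  then obtain x where x: "X = diag_t x" by (auto simp: lie_t_eq_range)
  define z where "z k = x k - kvec f k" for k
  have z: "z l + (\<Sum>j\<in>UNIV. z j) = 0" for l
  proof -
    have "killing X (e_vec l) = killing (diag_t (kvec f)) (e_vec l)"
      using X killing_kvec[OF f] by (simp add: e_vec_eq diag_t_in_lie_t)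
    then have "x l + (\<Sum>j\<in>UNIV. x j) = kvec f l + (\<Sum>j\<in>UNIV. kvec f j)"
      unfolding x e_vec_eq killing_diag_t
      by (simp add: if_distrib[of "\<lambda>z. _ * z"] add_nonneg_eq_0_iff cong: if_cong)
    then show ?thesis by (simp add: z_def sum_subtractf)
  qed
  then have "(\<Sum>l\<in>UNIV. z l + (\<Sum>j\<in>UNIV. z j)) = 0" by simp
  then have "(1 + real CARD('n)) * (\<Sum>j\<in>UNIV. z j) = 0"
    by (simp add: sum.distrib distrib_right)
  then have "(\<Sum>j\<in>UNIV. z j) = 0" by (simp add: add_nonneg_eq_0_iff)
  with z have "z = (\<lambda>_. 0)" by auto
  then have "x = kvec f" by (simp add: z_def fun_eq_iff)
  then show "X = diag_t (kvec f)" by (simp add: x)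
qed

lemma beta_in_dual: "beta k \<in> dual lie_t"
  using subspace_add[OF subspace_lie_t] subspace_scale[OF subspace_lie_t]
  by (auto simp: dual_def beta_def e_dual_def sum.distrib sum_distrib_left algebra_simps)

text \<open>Pairing with \<open>beta k\<close> evaluates it, up to sign, at the vector representing
  \<Lambda>, where it returns the coordinate \<open>k\<close> plus the sum of all coordinates. This
  is the quantity below up to a positive factor.\<close>

lemma C_hol_pos:
  assumes "\<Lambda> \<in> C_hol"
  shows "\<Lambda> (chi_vec k) + (\<Sum>j\<in>UNIV. \<Lambda> (chi_vec (j :: 'n::{finite,linorder}))) > 0"
proof -
  have L: "\<Lambda> \<in> dual lie_t" using assms by (simp add: C_hol_def t_plus_def)
  have "0 < t_dual_inner (beta k) \<Lambda>" using assms by (simp add: C_hol_def)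
  also have "t_dual_inner (beta k) \<Lambda> = - beta k (diag_t (kvec \<Lambda>))"
    by (simp add: t_dual_inner_def killing_vec_lie_t[OF L] killing_vec_lie_t[OF beta_in_dual] killing_kvec[OF beta_in_dual] diag_t_in_lie_t)
  also have "\<dots> = - (kvec \<Lambda> k + (\<Sum>j\<in>UNIV. kvec \<Lambda> j))"
    by (simp add: beta_def e_dual_def diag_t_in_lie_t)
  also have "\<dots> = (\<Lambda> (chi_vec k) + (\<Sum>j\<in>UNIV. \<Lambda> (chi_vec j))) / (2 * (real CARD('n) + 1)\<^sup>2)"
    by (simp add: kvec_def add_divide_distrib diff_divide_distrib sum_negf flip: sum_divide_distrib)
  finally show ?thesis by (simp add: zero_less_divide_iff not_less)
qed

text \<open>Both \<open>killing_eq\<close> and the restriction in \<open>killing_embed\<close> speak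
  of elements of \<open>lie_g\<close>, so conjugates must be known to stay there.\<close>

lemma conjugate_in_lie_g:
  assumes g: "g \<in> SU_n1" and Z: "Z \<in> lie_g"
  shows "matrix_inv g ** Z ** g \<in> lie_g"
proof -
  have gf: "g \<in> form_group I_n1" using g by (simp add: SU_n1_eq)
  let ?h = "I_n1 ** conj_transpose g ** I_n1"
  have h: "matrix_inv g = ?h" by (rule form_group_matrix_inv[OF I_n1_mult_I_n1 gf])
  have gh: "g ** ?h = mat 1" by (rule form_group_inverse[OF I_n1_mult_I_n1 gf])
  have 1: "I_n1 ** ?h = conj_transpose g ** I_n1"
    by (simp add: matrix_mul_assoc I_n1_mult_I_n1)
  have 2: "conj_transpose ?h ** I_n1 = I_n1 ** g"
    by (simp add: conj_transpose_mult conj_transpose_I_n1 I_n1_mult_I_n1 flip: matrix_mul_assoc)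
  have "conj_transpose (?h ** Z ** g) ** I_n1 = conj_transpose g ** conj_transpose Z ** (conj_transpose ?h ** I_n1)"
    by (simp only: conj_transpose_mult matrix_mul_assoc)
  also have "\<dots> = conj_transpose g ** (conj_transpose Z ** I_n1) ** g"
    unfolding 2 by (simp only: matrix_mul_assoc)
  also have "\<dots> = - (conj_transpose g ** I_n1 ** Z ** g)"
    unfolding lie_g_swap[OF Z] by (simp add: matrix_mult_minus matrix_mul_assoc)
  also have "\<dots> = - (I_n1 ** (?h ** Z ** g))"
    unfolding 1[symmetric] by (simp only: matrix_mul_assoc)
  finally have "conj_transpose (?h ** Z ** g) ** I_n1 + I_n1 ** (?h ** Z ** g) = 0"
    by simp
  moreover have "trace (?h ** Z ** g) = trace (Z ** (g ** ?h))"
    by (metis matrix_mul_assoc trace_mul_sym)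
  ultimately show ?thesis using Z unfolding h gh by (simp add: lie_g_eq)
qed

text \<open>\<open>form_group_row\<close> trades the contribution of the last column for
  \<open>A A* - 1\<close>. The first part is absorbed into the weights \<open>x k\<close>, and the
  second leaves minus the sum of the \<open>x l\<close> on the diagonal.\<close>

lemma conjugate_diag_t_nth:
  assumes g: "g \<in> SU_n1"
  shows "(g ** diag_t x ** matrix_inv g) $ Some i $ Some j =
    \<i> * ((\<Sum>k\<in>UNIV. complex_of_real (x k + (\<Sum>l\<in>UNIV. x l)) * g $ Some i $ Some k * cnj (g $ Some j $ Some k))
      - (if i = j then complex_of_real (\<Sum>l\<in>UNIV. x l) else 0))"
proof -
  have gf: "g \<in> form_group I_n1" using g by (simp add: SU_n1_eq)
  define S where "S = complex_of_real (\<Sum>l\<in>UNIV. x l)"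
  have e: "complex_of_real (x k + (\<Sum>l\<in>UNIV. x l)) = complex_of_real (x k) + S" for k
    by (simp add: S_def)
  have row: "(\<Sum>k\<in>UNIV. g $ Some i $ Some k * cnj (g $ Some j $ Some k)) =
      (if i = j then 1 else 0) + g $ Some i $ None * cnj (g $ Some j $ None)"
    using arg_cong[OF form_group_row[OF I_n1_mult_I_n1 gf], of "\<lambda>M. M $ Some i $ Some j"]
    by (simp add: mult_I_n1_mult_nth diff_eq_eq)
  have D: "(g ** diag_t x) $ p $ Some k = \<i> * x k * g $ p $ Some k" "(g ** diag_t x) $ p $ None = - \<i> * S * g $ p $ None" for p k
    by (simp_all add: S_def matrix_matrix_mult_def sum_UNIV_option if_distrib[of "\<lambda>z. _ * z"] cong: if_cong)
  have "(g ** diag_t x ** matrix_inv g) $ Some i $ Some j = ((g ** diag_t x) ** I_n1 ** conj_transpose g) $ Some i $ Some j"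
    by (simp add: form_group_matrix_inv[OF I_n1_mult_I_n1 gf] matrix_mul_assoc)
  also have "\<dots> = \<i> * ((\<Sum>k\<in>UNIV. complex_of_real (x k) * g $ Some i $ Some k * cnj (g $ Some j $ Some k))
      + S * (g $ Some i $ None * cnj (g $ Some j $ None)))"
    unfolding mult_I_n1_mult_nth D by (simp add: sum_distrib_left algebra_simps)
  also have "g $ Some i $ None * cnj (g $ Some j $ None) =
      (\<Sum>k\<in>UNIV. g $ Some i $ Some k * cnj (g $ Some j $ Some k)) - (if i = j then 1 else 0)"
    unfolding row by simp
  finally show ?thesis unfolding e S_def[symmetric]
    by (cases "i = j") (simp_all add: distrib_right sum.distrib sum_distrib_left right_diff_distrib mult.assoc add_diff_eq)
qed

text \<open>Functionals on \<open>lie_k\<close> compare the two diagonal blocks, and vanishing trace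
  ties the corner to the upper left block. Conversely the trace form is negative definite on
  \<open>lie_k\<close>, so testing on the block part of \<open>A - B\<close> detects any
  difference.\<close>

lemma lie_k_projection_iff:
  fixes A B :: "('n::finite) cmat"
  assumes A: "A \<in> lie_g" and B: "B \<in> lie_g"
  shows "(\<forall>Z\<in>lie_k. Re (trace (B ** Z)) = Re (trace (A ** Z))) \<longleftrightarrow> (\<forall>i j. A $ Some i $ Some j = B $ Some i $ Some j)"
proof -
  have tr: "trace (M ** Z) = (\<Sum>i\<in>UNIV. \<Sum>j\<in>UNIV. M $ Some i $ Some j * Z $ Some j $ Some i) + M $ None $ None * Z $ None $ None"
    if "Z \<in> lie_k" for M Z :: "'n cmat"
    using that by (simp add: trace_UNIV_option matrix_matrix_mult_def sum_UNIV_option lie_k_eq)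
  show ?thesis
  proof
    assume eq: "\<forall>i j. A $ Some i $ Some j = B $ Some i $ Some j"
    have "trace A = trace B" using A B by (simp add: lie_g_eq)
    then have "A $ None $ None = B $ None $ None" using eq by (simp add: trace_UNIV_option)
    then show "\<forall>Z\<in>lie_k. Re (trace (B ** Z)) = Re (trace (A ** Z))" using eq by (simp add: tr)
  next
    assume eq: "\<forall>Z\<in>lie_k. Re (trace (B ** Z)) = Re (trace (A ** Z))"
    define C where "C = A - B"
    have Cg: "C \<in> lie_g" unfolding C_def by (rule subspace_diff[OF subspace_lie_g A B])
    define Z where "Z = block_diag (upper_left C) (C $ None $ None)"
    have "(conj_transpose C ** I_n1 + I_n1 ** C) $ p $ q = 0" for p q
      using Cg by (simp add: lie_g_eq)
    from this[of "Some _" "Some _"] this[of None None]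
    have Cs: "cnj (C $ Some j $ Some i) = - C $ Some i $ Some j" "cnj (C $ None $ None) = - C $ None $ None" for i j
      by (simp_all add: eq_neg_iff_add_eq_0) (metis add.inverse_inverse add_eq_0_iff)
    have Zk: "Z \<in> lie_k"
      using Cg Cs by (simp add: lie_k_eq lie_g_eq Z_def vec_eq_option_iff trace_UNIV_option)
    have neg: "z * w = - of_real ((cmod z)\<^sup>2)" if "cnj z = - w" for z w
      using that by (simp only: complex_norm_square) simp
    have "0 = Re (trace (C ** Z))"
      using eq Zk by (simp add: C_def bounded_bilinear.diff_left[OF bounded_bilinear_matrix_mult] trace_sub)
    also have "trace (C ** Z) = - of_real ((\<Sum>i\<in>UNIV. \<Sum>j\<in>UNIV. (cmod (C $ Some i $ Some j))\<^sup>2) + (cmod (C $ None $ None))\<^sup>2)"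
      unfolding tr[OF Zk] by (simp add: Z_def neg[OF Cs(1)] neg[OF Cs(2)] sum_negf del: of_real_power)
    finally have "(\<Sum>i\<in>UNIV. \<Sum>j\<in>UNIV. (cmod (C $ Some i $ Some j))\<^sup>2) + (cmod (C $ None $ None))\<^sup>2 = 0"
      by simp
    then have "(\<Sum>i\<in>UNIV. \<Sum>j\<in>UNIV. (cmod (C $ Some i $ Some j))\<^sup>2) = 0"
      by (subst (asm) add_nonneg_eq_0_iff) (auto intro!: sum_nonneg)
    then have "(cmod (C $ Some i $ Some j))\<^sup>2 = 0" for i j
      by (simp add: sum_nonneg_eq_0_iff sum_nonneg)
    then show "\<forall>i j. A $ Some i $ Some j = B $ Some i $ Some j" by (simp add: C_def)
  qed
qed

text \<open>Membership as the matrix equation \<open>A \<mu> A* = diag\<close>. The same shift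
  \<open>s\<close>, computed from \<Lambda>, appears on both sides: it is the scalar added to the
  orbit matrix and so passes unchanged to its block.\<close>

lemma Delta_K_iff:
  fixes \<Lambda> :: "('n::{finite,linorder}) cmat \<Rightarrow> real"
  assumes L: "\<Lambda> \<in> dual lie_t"
  defines "s \<equiv> \<Sum>j\<in>UNIV. \<Lambda> (chi_vec j)"
  shows "\<xi> \<in> Delta_K (coadjoint_orbit \<Lambda>) \<longleftrightarrow> \<xi> \<in> t_plus \<and>
    (\<exists>g\<in>SU_n1. \<forall>i j. (\<Sum>k\<in>UNIV. complex_of_real (\<Lambda> (chi_vec k) + s) * g $ Some i $ Some k * cnj (g $ Some j $ Some k)) =
      (if i = j then complex_of_real (\<xi> (chi_vec i) + s) else 0))"
proof (cases "\<xi> \<in> t_plus")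
  case False
  then show ?thesis by (simp add: Delta_K_def)
next
  case True
  then have X: "\<xi> \<in> dual lie_t" by (simp add: t_plus_def)
  define c where "c = - 1 / (2 * (real CARD('n) + 1)\<^sup>2)"
  have c: "c \<noteq> 0" by (simp add: c_def add_nonneg_eq_0_iff)
  have kv: "kvec f k = c * f (chi_vec k)" for f and k :: 'n by (simp add: kvec_def c_def)
  have diag_g: "diag_t x \<in> lie_g" for x :: "'n \<Rightarrow> real"
    using diag_t_in_lie_t lie_t_subset_lie_k lie_k_subset_lie_g by blast
  have "killing_embed lie_t lie_k \<xi> = restrict (coadjoint g (killing_embed lie_t lie_g \<Lambda>)) lie_k \<longleftrightarrow>
     (\<forall>i j. (\<Sum>k\<in>UNIV. complex_of_real (\<Lambda> (chi_vec k) + s) * g $ Some i $ Some k * cnj (g $ Some j $ Some k)) =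
      (if i = j then complex_of_real (\<xi> (chi_vec i) + s) else 0))" if g: "g \<in> SU_n1" for g
  proof -
    let ?M = "g ** diag_t (kvec \<Lambda>) ** matrix_inv g"
    have gf: "g \<in> form_group I_n1" using g by (simp add: SU_n1_eq)
    have inv: "matrix_inv g ** g = mat 1" "g ** matrix_inv g = mat 1"
      unfolding form_group_matrix_inv[OF I_n1_mult_I_n1 gf] using form_group_inverse[OF I_n1_mult_I_n1 gf] by auto
    \<comment> \<open>\<open>conjugate_in_lie_g\<close> conjugates in the direction used by
      \<open>coadjoint\<close>; it reaches \<open>?M\<close> only when applied to the inverse of
      \<open>g\<close>.\<close>
    have h: "matrix_inv g \<in> SU_n1"
    proof -
      have "conj_transpose (matrix_inv g) ** (conj_transpose g ** I_n1 ** g) ** matrix_inv g =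
          conj_transpose (g ** matrix_inv g) ** I_n1 ** (g ** matrix_inv g)"
        by (simp only: conj_transpose_mult matrix_mul_assoc)
      then have "conj_transpose (matrix_inv g) ** I_n1 ** matrix_inv g = I_n1"
        using gf by (simp add: form_group_def inv)
      moreover have "det (matrix_inv g) = 1"
        using arg_cong[OF inv(1), of det] g by (simp add: det_mul SU_n1_eq)
      ultimately show ?thesis by (simp add: SU_n1_def)
    qed
    have "matrix_inv (matrix_inv g) = g"
    proof -
      have "matrix_inv (matrix_inv g) ** (matrix_inv g ** g) = (matrix_inv (matrix_inv g) ** matrix_inv g) ** g"
        by (simp only: matrix_mul_assoc)
      moreover have "matrix_inv (matrix_inv g) ** matrix_inv g = mat 1"
      proof -
        have hf: "matrix_inv g \<in> form_group I_n1" using h by (simp add: SU_n1_eq)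
        show ?thesis
          unfolding form_group_matrix_inv[OF I_n1_mult_I_n1 hf]
          by (rule form_group_inverse(1)[OF I_n1_mult_I_n1 hf])
      qed
      ultimately show ?thesis by (simp add: inv)
    qed
    then have M: "?M \<in> lie_g" using conjugate_in_lie_g[OF h diag_g[of "kvec \<Lambda>"]] by simp
    \<comment> \<open>Cyclicity of the trace moves the conjugation from the argument
      \<open>Z\<close> to the representing matrix.\<close>
    have coad: "coadjoint g (killing_embed lie_t lie_g \<Lambda>) Z = 2 * (real CARD('n) + 1) * Re (trace (?M ** Z))"
      if Z: "Z \<in> lie_k" for Z
    proof -
      have Zg: "Z \<in> lie_g" using Z lie_k_subset_lie_g by blast
      have "trace (diag_t (kvec \<Lambda>) ** (matrix_inv g ** Z ** g)) = trace (?M ** Z)"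
        by (metis matrix_mul_assoc trace_mul_sym)
      then show ?thesis
        using Zg conjugate_in_lie_g[OF g Zg]
        by (simp add: coadjoint_def killing_embed_def killing_vec_lie_t[OF L] killing_eq[OF diag_g])
    qed
    have "killing_embed lie_t lie_k \<xi> = restrict (coadjoint g (killing_embed lie_t lie_g \<Lambda>)) lie_k \<longleftrightarrow>
      (\<forall>Z\<in>lie_k. killing_embed lie_t lie_k \<xi> Z = coadjoint g (killing_embed lie_t lie_g \<Lambda>) Z)"
      by (auto simp: fun_eq_iff killing_embed_def restrict_def)
    also have "\<dots> \<longleftrightarrow> (\<forall>Z\<in>lie_k. Re (trace (diag_t (kvec \<xi>) ** Z)) = Re (trace (?M ** Z)))"
    proof (intro ball_cong refl)
      fix Z :: "'n cmat" assume Z: "Z \<in> lie_k"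
      then have "Z \<in> lie_g" using lie_k_subset_lie_g by blast
      then have "killing_embed lie_t lie_k \<xi> Z = 2 * (real CARD('n) + 1) * Re (trace (diag_t (kvec \<xi>) ** Z))"
        using Z by (simp add: killing_embed_def killing_vec_lie_t[OF X] killing_eq[OF diag_g])
      then show "killing_embed lie_t lie_k \<xi> Z = coadjoint g (killing_embed lie_t lie_g \<Lambda>) Z \<longleftrightarrow>
        Re (trace (diag_t (kvec \<xi>) ** Z)) = Re (trace (?M ** Z))"
        unfolding coad[OF Z] by (simp add: add_nonneg_eq_0_iff)
    qed
    also have "\<dots> \<longleftrightarrow> (\<forall>i j. ?M $ Some i $ Some j = diag_t (kvec \<xi>) $ Some i $ Some j)"
      by (rule lie_k_projection_iff[OF M diag_g])
    also have "\<dots> \<longleftrightarrow> (\<forall>i j. (\<Sum>k\<in>UNIV. complex_of_real (\<Lambda> (chi_vec k) + s) * g $ Some i $ Some k * cnj (g $ Some j $ Some k)) =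
      (if i = j then complex_of_real (\<xi> (chi_vec i) + s) else 0))"
    proof (intro all_cong1)
      fix i j
      let ?G = "\<Sum>k\<in>UNIV. complex_of_real (\<Lambda> (chi_vec k) + s) * g $ Some i $ Some k * cnj (g $ Some j $ Some k)"
      have S: "(\<Sum>l\<in>UNIV. kvec \<Lambda> l) = c * s" by (simp add: kv s_def sum_distrib_left)
      have "(\<Sum>k\<in>UNIV. complex_of_real (kvec \<Lambda> k + (\<Sum>l\<in>UNIV. kvec \<Lambda> l)) * g $ Some i $ Some k * cnj (g $ Some j $ Some k)) =
          of_real c * ?G"
        unfolding S by (simp add: kv sum_distrib_left algebra_simps)
      then have "?M $ Some i $ Some j = \<i> * (of_real c * ?G - (if i = j then of_real (c * s) else 0))"
        unfolding conjugate_diag_t_nth[OF g] S by simp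
      also have "\<dots> = (\<i> * of_real c) * (?G - (if i = j then of_real s else 0))"
        by (simp add: algebra_simps)
      also have "diag_t (kvec \<xi>) $ Some i $ Some j = (\<i> * of_real c) * (if i = j then of_real (\<xi> (chi_vec i)) else 0)"
        by (simp add: kv)
      ultimately show "?M $ Some i $ Some j = diag_t (kvec \<xi>) $ Some i $ Some j \<longleftrightarrow>
        ?G = (if i = j then complex_of_real (\<xi> (chi_vec i) + s) else 0)"
        using c by (auto simp: diff_eq_eq)
    qed
    finally show ?thesis .
  qed
  with True show ?thesis by (auto simp: Delta_K_def coadjoint_orbit_def image_iff)
qed

text \<open>The theorem relates adjacent indices only, while \<open>SU_n1_interlacing\<close> asks
  for all \<open>k < l\<close>. The predecessor \<open>m\<close> of \<open>l\<close> bridges the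
  gap, the values of \<Lambda> being weakly decreasing from \<open>k\<close> to
  \<open>m\<close>.\<close>

lemma consecutive_predecessor:
  fixes k l :: "'a::{finite,linorder}"
  assumes "k < l"
  obtains m where "k \<le> m" "consecutive m l"
proof
  let ?m = "Max {j. j < l}"
  have ne: "{j. j < l} \<noteq> {}" using assms by blast
  show "k \<le> ?m" using assms by (intro Max_ge) auto
  show "consecutive ?m l" unfolding consecutive_def
    using Max_in[OF _ ne] Max_ge[of "{j. j < l}"] by (auto simp: not_less)
qed

theorem mainTheorem9:
  fixes \<Lambda> :: "('n::{finite,linorder}) cmat \<Rightarrow> real"
  assumes "CARD('n) \<ge> 2"
    and "\<Lambda> \<in> wedge_Q_plus \<inter> C_hol"
  shows "Delta_K (coadjoint_orbit \<Lambda>) =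
    {\<xi> \<in> dual lie_t.
       (\<forall>k::'n. \<xi> (chi_vec k) \<ge> \<Lambda> (chi_vec k)) \<and>
       (\<forall>k l::'n. consecutive k l \<longrightarrow> \<Lambda> (chi_vec k) \<ge> \<xi> (chi_vec l))}"
proof (intro set_eqI iffI CollectI)
  have L: "\<Lambda> \<in> dual lie_t" "\<Lambda> \<in> t_plus" using assms(2) by (auto simp: C_hol_def t_plus_def)
  define s where "s = (\<Sum>j\<in>UNIV. \<Lambda> (chi_vec (j::'n)))"
  have pos: "\<Lambda> (chi_vec k) + s > 0" for k
    unfolding s_def using assms(2) by (intro C_hol_pos) auto
  \<comment> \<open>Differences of values on \<open>chi_vec\<close> are \<open>n + 1\<close> times
    differences of coordinates, so the chamber can be read off from either.\<close>
  have mono: "f (chi_vec k) \<ge> f (chi_vec l) \<longleftrightarrow> f (e_vec k) \<ge> f (e_vec l)" if "f \<in> dual lie_t" for f and k l :: 'n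
    by (simp add: dual_chi_vec[OF that] mult_le_cancel_left add_nonneg_pos)
  have Lmono: "\<Lambda> (chi_vec l) \<le> \<Lambda> (chi_vec k)" if "k \<le> l" for k l :: 'n
    using L(2) that by (auto simp: mono[OF L(1)] t_plus_def)
  {
    fix \<xi> assume "\<xi> \<in> Delta_K (coadjoint_orbit \<Lambda>)"
    then obtain g where t: "\<xi> \<in> t_plus" and g: "g \<in> SU_n1" and
      eq: "\<And>i j. (\<Sum>k\<in>UNIV. complex_of_real (\<Lambda> (chi_vec k) + s) * g $ Some i $ Some k * cnj (g $ Some j $ Some k)) =
      (if i = j then complex_of_real (\<xi> (chi_vec i) + s) else 0)"
      unfolding Delta_K_iff[OF L(1)] s_def by blast
    have X: "\<xi> \<in> dual lie_t" using t by (simp add: t_plus_def)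
    have Xmono: "\<xi> (chi_vec l) \<le> \<xi> (chi_vec k)" if "k \<le> l" for k l :: 'n
      using t that by (auto simp: mono[OF X] t_plus_def)
    have "g \<in> form_group I_n1" using g by (simp add: SU_n1_eq)
    from form_group_row[OF I_n1_mult_I_n1 this]
    have row: "(\<Sum>k\<in>UNIV. g $ Some i $ Some k * cnj (g $ Some j $ Some k)) =
      (if i = j then 1 else 0) + g $ Some i $ None * cnj (g $ Some j $ None)" for i j
      by (auto dest!: arg_cong[of _ _ "\<lambda>M. M $ Some i $ Some j"] simp: mult_I_n1_mult_nth diff_eq_eq)
    have "\<Lambda> (chi_vec k) + s \<le> \<xi> (chi_vec k) + s" for k
      by (rule interlacing_necessary(1)[OF _ _ pos eq row]) (use Xmono Lmono in auto)
    moreover have "\<xi> (chi_vec l) + s \<le> \<Lambda> (chi_vec k) + s" if "consecutive k l" for k l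
      by (rule interlacing_necessary(2)[OF _ _ pos eq row that]) (use Xmono Lmono in auto)
    ultimately show "\<xi> \<in> dual lie_t \<and> (\<forall>k::'n. \<xi> (chi_vec k) \<ge> \<Lambda> (chi_vec k)) \<and>
       (\<forall>k l::'n. consecutive k l \<longrightarrow> \<Lambda> (chi_vec k) \<ge> \<xi> (chi_vec l))"
      using X by simp
  next
    fix \<xi> assume "\<xi> \<in> {\<xi> \<in> dual lie_t. (\<forall>k::'n. \<xi> (chi_vec k) \<ge> \<Lambda> (chi_vec k)) \<and>
       (\<forall>k l::'n. consecutive k l \<longrightarrow> \<Lambda> (chi_vec k) \<ge> \<xi> (chi_vec l))}"
    then have X: "\<xi> \<in> dual lie_t" and ge: "\<And>k. \<xi> (chi_vec k) \<ge> \<Lambda> (chi_vec k)"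
      and con: "\<And>k l. consecutive k l \<Longrightarrow> \<Lambda> (chi_vec k) \<ge> \<xi> (chi_vec l)" by auto
    have le: "\<xi> (chi_vec l) \<le> \<Lambda> (chi_vec k)" if kl: "k < l" for k l
    proof -
      obtain m where "k \<le> m" "consecutive m l" by (rule consecutive_predecessor[OF kl])
      then show ?thesis using con Lmono by (meson order_trans)
    qed
    \<comment> \<open>The inequalities themselves place \<xi> in the chamber: a value of \<Lambda>
      separates \<open>\<xi> (chi_vec k)\<close> from \<open>\<xi> (chi_vec l)\<close> whenever
      \<open>k < l\<close>.\<close>
    have "\<xi> (chi_vec l) \<le> \<xi> (chi_vec k)" if "k \<le> l" for k l
      using le[of k l] ge[of k] that by (cases k l rule: linorder_cases) auto
    then have "\<xi> \<in> t_plus" using X by (simp add: t_plus_def mono[OF X])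
    moreover have "\<exists>g\<in>SU_n1. \<forall>i j. (\<Sum>k\<in>UNIV. complex_of_real (\<Lambda> (chi_vec k) + s) * g $ Some i $ Some k * cnj (g $ Some j $ Some k)) =
      (if i = j then complex_of_real (\<xi> (chi_vec i) + s) else 0)"
      by (rule SU_n1_interlacing[where \<mu> = "\<lambda>k. \<Lambda> (chi_vec k) + s"]) (use pos ge le in auto)
    ultimately show "\<xi> \<in> Delta_K (coadjoint_orbit \<Lambda>)"
      unfolding Delta_K_iff[OF L(1)] s_def by blast
  }
qed

end
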